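(* Let $S_u$ be the unilateral operator weighted shift on $\widehat{\mathcal H}$ with weight sequence $(A_n)_{n\ge 0}$. If $S_u$ possesses Bishop's property $(\beta)$, then $r_2(S_u)=r_1(S_u)$ and $r(S_u)=R_3^+(S_u)$. Moreover, for every non-zero $x\in\mathcal H$, $$\lim_{n\to+\infty}\bigg[\inf_{k\ge 0}\frac{\|B_{n+k}x\|}{\|B_kx\|}\bigg]^{\frac1n}=\lim_{n\to+\infty}\bigg[\sup_{k\ge 0}\frac{\|B_{n+k}x\|}{\|B_kx\|}\bigg]^{\frac1n}.$$
   Context: $\mathcal H$ is a non-zero complex Hilbert space, $\mathcal L(\mathcal H)$ is the algebra of bounded linear operators on $\mathcal H$, and $(A_n)_{n\ge0}$ is a uniformly bounded sequence of invertible operators in $\mathcal L(\mathcal H)$ (no uniform bound on the inverses is assumed). $\widehat{\mathcal H}=\sum_{n\ge0}\oplus\mathcal H$ is the Hilbert space of sequences $(x_n)_{n\ge0}$ in $\mathcal H$ with $\sum_n\|x_n\|^2<\infty$. The unilateral operator weighted shift $S_u$ on $\widehat{\mathcal H}$ is $S_u(x_0,x_1,x_2,\dots)=(0,A_0x_0,A_1x_1,A_2x_2,\dots)$. Set $B_0=I$ and $B_n=A_{n-1}A_{n-2}\cdots A_1A_0$ for $n>0$. $r(\cdot)$ denotes the spectral radius. For a bounded operator $T$, $m(T):=\inf\{\|Tx\|:\|x\|=1\}$ and $r_1(T):=\lim_{n\to\infty}m(T^n)^{1/n}=\sup_{n\ge1}m(T^n)^{1/n}$ (the limit exists). With the convention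 $1/{+\infty}=0$, $$r_2(S_u):=\frac{1}{\limsup_{n\to+\infty}\|B_n^{-1}\|^{1/n}},\qquad R_3^+(S_u):=\sup_{x\in\mathcal H,\ x\ne0}\ \limsup_{n\to+\infty}\|B_nx\|^{\frac1n}.$$ For an open set $U\subset\mathbb C$ and a Hilbert space $\mathcal K$, $\mathcal O(U,\mathcal K)$ is the Fréchet space of analytic $\mathcal K$-valued functions on $U$ (topology of uniform convergence on compact subsets). A bounded operator $T$ on $\mathcal K$ possesses Bishop's property $(\beta)$ if for every open $U\subset\mathbb C$ the continuous map $T_U:\mathcal O(U,\mathcal K)\to\mathcal O(U,\mathcal K)$, $(T_Uf)(z)=(T-z)f(z)$, is injective with closed range. *)

theory Defs
  imports "HOL-Analysis.Analysis"
begin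

section \<open>Complex Hilbert spaces\<close>

text \<open>The inner product is linear in the first argument. The axiom \<open>cinner_self\<close> ties it to the
  norm of the underlying Banach space and contains positive definiteness.\<close>

class complex_hilbert_space = banach +
  fixes scaleC :: "complex \<Rightarrow> 'a \<Rightarrow> 'a" (infixr "*\<^sub>C" 75)
    and cinner :: "'a \<Rightarrow> 'a \<Rightarrow> complex"
  assumes scaleC_add_right: "c *\<^sub>C (x + y) = c *\<^sub>C x + c *\<^sub>C y"
    and scaleC_add_left: "(c + d) *\<^sub>C x = c *\<^sub>C x + d *\<^sub>C x"
    and scaleC_scaleC: "c *\<^sub>C d *\<^sub>C x = (c * d) *\<^sub>C x"
    and scaleR_scaleC: "r *\<^sub>R x = complex_of_real r *\<^sub>C x"
    and cinner_commute: "cinner x y = cnj (cinner y x)"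
    and cinner_add_left: "cinner (x + y) z = cinner x z + cinner y z"
    and cinner_scaleC_left: "cinner (c *\<^sub>C x) y = c * cinner x y"
    and cinner_self: "cinner x x = complex_of_real ((norm x)\<^sup>2)"

lemma norm_scaleC: "norm (c *\<^sub>C x) = cmod c * norm (x :: 'a :: complex_hilbert_space)"
proof -
  have "complex_of_real ((norm (c *\<^sub>C x))\<^sup>2) = c * cinner x (c *\<^sub>C x)"
    by (metis cinner_self cinner_scaleC_left)
  also have "cinner x (c *\<^sub>C x) = cnj c * cinner x x"
    by (metis cinner_commute cinner_scaleC_left complex_cnj_mult)
  also have "c * (cnj c * cinner x x) = complex_of_real ((cmod c * norm x)\<^sup>2)"
    unfolding cinner_self
    by (simp add: power_mult_distrib flip: complex_norm_square mult.assoc)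
  finally have "(norm (c *\<^sub>C x))\<^sup>2 = (cmod c * norm x)\<^sup>2"
    by (simp only: of_real_eq_iff)
  then show ?thesis
    by (simp add: power2_eq_iff_nonneg)
qed

lemma norm_cinner_le: "2 * cmod (cinner x y) \<le> (norm x)\<^sup>2 + (norm (y :: 'a :: complex_hilbert_space))\<^sup>2"
proof -
  define u where "u = (if cinner x y = 0 then 1 else - cnj (cinner x y) / cmod (cinner x y))"
  have u: "cmod u = 1"
    by (simp add: u_def norm_divide)
  have uc: "u * cinner x y = - complex_of_real (cmod (cinner x y))"
  proof (cases "cinner x y = 0")
    case False
    have "u * cinner x y = - (cinner x y * cnj (cinner x y)) / cmod (cinner x y)"
      using False by (simp add: u_def mult.commute)
    also have "\<dots> = - ((complex_of_real (cmod (cinner x y)))\<^sup>2 / cmod (cinner x y))"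
      by (simp add: complex_norm_square[symmetric])
    finally show ?thesis
      using False by (simp add: power2_eq_square)
  qed simp
  have right: "cinner z (v + w) = cinner z v + cinner z w" for z v w :: 'a
    by (metis cinner_commute cinner_add_left complex_cnj_add)
  have "complex_of_real ((norm (u *\<^sub>C x + y))\<^sup>2)
      = cinner (u *\<^sub>C x) (u *\<^sub>C x) + cinner y y + (u * cinner x y + cnj (u * cinner x y))"
  proof -
    have "cinner y (u *\<^sub>C x) = cnj (u * cinner x y)"
      by (metis cinner_commute cinner_scaleC_left)
    then show ?thesis
      unfolding cinner_self[symmetric] cinner_add_left right
      by (simp only: cinner_scaleC_left[of u x y] add_ac)
  qed
  also have "\<dots> = complex_of_real ((norm x)\<^sup>2 + (norm y)\<^sup>2 - 2 * cmod (cinner x y))"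
    by (simp add: uc cinner_self norm_scaleC u)
  finally have "(norm (u *\<^sub>C x + y))\<^sup>2 = (norm x)\<^sup>2 + (norm y)\<^sup>2 - 2 * cmod (cinner x y)"
    by (simp only: of_real_eq_iff)
  then show ?thesis
    by (metis diff_ge_0_iff_ge zero_le_power2)
qed

section \<open>The Hilbert sum of countably many copies of a Hilbert space\<close>

typedef (overloaded) 'a l2 = "{x :: nat \<Rightarrow> 'a :: complex_hilbert_space. summable (\<lambda>n. (norm (x n))\<^sup>2)}"
  morphisms l2_nth Abs_l2
  by (intro exI[of _ "\<lambda>_. 0"]) simp

lemma summable_l2: "summable (\<lambda>n. (norm (l2_nth x n))\<^sup>2)"
  using l2_nth[of x] by simp

lemma l2_nth_Abs: "summable (\<lambda>n. (norm (x n))\<^sup>2) \<Longrightarrow> l2_nth (Abs_l2 x) = x"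
  by (simp add: Abs_l2_inverse)

lemma l2_eqI: "(\<And>n. l2_nth x n = l2_nth y n) \<Longrightarrow> x = y"
  by (metis ext l2_nth_inject)

lemma summable_l2_add:
  fixes x y :: "nat \<Rightarrow> 'a :: real_normed_vector"
  assumes "summable (\<lambda>n. (norm (x n))\<^sup>2)" "summable (\<lambda>n. (norm (y n))\<^sup>2)"
  shows "summable (\<lambda>n. (norm (x n + y n))\<^sup>2)"
proof (rule summable_comparison_test')
  show "summable (\<lambda>n. 2 * (norm (x n))\<^sup>2 + 2 * (norm (y n))\<^sup>2)"
    by (intro summable_add summable_mult assms)
  show "norm ((norm (x n + y n))\<^sup>2) \<le> 2 * (norm (x n))\<^sup>2 + 2 * (norm (y n))\<^sup>2" if "n \<ge> 0" for n
  proof -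
    have "(norm (x n + y n))\<^sup>2 \<le> (norm (x n) + norm (y n))\<^sup>2"
      by (intro power_mono norm_triangle_ineq) auto
    also have "\<dots> \<le> 2 * (norm (x n))\<^sup>2 + 2 * (norm (y n))\<^sup>2"
      using sum_squares_bound[of "norm (x n)" "norm (y n)"] by (simp add: power2_sum)
    finally show ?thesis by simp
  qed
qed

lemma summable_l2_bounded:
  fixes x y :: "nat \<Rightarrow> 'a :: real_normed_vector"
  assumes "summable (\<lambda>n. (norm (x n))\<^sup>2)" "\<And>n. norm (y n) \<le> M * norm (x n)"
  shows "summable (\<lambda>n. (norm (y n))\<^sup>2)"
proof (rule summable_comparison_test')
  show "summable (\<lambda>n. M\<^sup>2 * (norm (x n))\<^sup>2)"
    by (intro summable_mult assms)
  show "norm ((norm (y n))\<^sup>2) \<le> M\<^sup>2 * (norm (x n))\<^sup>2" if "n \<ge> 0" for n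
    using power_mono[OF assms(2), of n 2] by (simp add: power_mult_distrib)
qed

instantiation l2 :: (complex_hilbert_space) real_normed_vector
begin

definition "0 = Abs_l2 (\<lambda>_. 0)"
definition "x + y = Abs_l2 (\<lambda>n. l2_nth x n + l2_nth y n)"
definition "- x = Abs_l2 (\<lambda>n. - l2_nth x n)"
definition "x - y = Abs_l2 (\<lambda>n. l2_nth x n - l2_nth y n)"
definition "r *\<^sub>R x = Abs_l2 (\<lambda>n. r *\<^sub>R l2_nth x n)"
definition "norm x = sqrt (\<Sum>n. (norm (l2_nth x n))\<^sup>2)"
definition "dist x y = norm (x - y)" for x y :: "'a l2"
definition "sgn x = inverse (norm x) *\<^sub>R x" for x :: "'a l2"
definition "uniformity = (INF e\<in>{0<..}. principal {(x, y :: 'a l2). dist x y < e})"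
definition "open U \<longleftrightarrow> (\<forall>x\<in>U. \<forall>\<^sub>F (x', y) in uniformity. x' = x \<longrightarrow> y \<in> U)" for U :: "'a l2 set"

lemma l2_nth_zero: "l2_nth (0 :: 'a l2) n = 0"
  by (simp add: zero_l2_def l2_nth_Abs)

lemma l2_nth_add: "l2_nth (x + y :: 'a l2) n = l2_nth x n + l2_nth y n"
  by (simp add: plus_l2_def l2_nth_Abs summable_l2_add summable_l2)

lemma l2_nth_uminus: "l2_nth (- x :: 'a l2) n = - l2_nth x n"
  by (simp add: uminus_l2_def l2_nth_Abs summable_l2)

lemma l2_nth_diff: "l2_nth (x - y :: 'a l2) n = l2_nth x n - l2_nth y n"
  using summable_l2_add[of "l2_nth x" "\<lambda>n. - l2_nth y n"]
  by (simp add: minus_l2_def l2_nth_Abs summable_l2)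

lemma l2_nth_scaleR: "l2_nth (r *\<^sub>R x :: 'a l2) n = r *\<^sub>R l2_nth x n"
  by (simp add: scaleR_l2_def l2_nth_Abs summable_l2 power_mult_distrib summable_mult)

lemma norm_l2_sq: "(norm (x :: 'a l2))\<^sup>2 = (\<Sum>n. (norm (l2_nth x n))\<^sup>2)"
  by (simp add: norm_l2_def suminf_nonneg summable_l2)

lemma L2_set_le_norm_l2: "L2_set (\<lambda>n. norm (l2_nth x n)) {..<N} \<le> norm (x :: 'a l2)"
  unfolding L2_set_def norm_l2_def
  by (intro real_sqrt_le_mono sum_le_suminf summable_l2) auto

lemma norm_l2_leI:
  assumes "\<And>N. L2_set (\<lambda>n. norm (l2_nth x n)) {..<N} \<le> C"
  shows "norm (x :: 'a l2) \<le> C"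
proof -
  have C: "C \<ge> 0"
    using assms[of 0] by (simp add: L2_set_def)
  have "(\<Sum>n<N. (norm (l2_nth x n))\<^sup>2) \<le> C\<^sup>2" for N
    using assms[of N] unfolding L2_set_def by (simp add: sqrt_le_D)
  then have "(norm x)\<^sup>2 \<le> C\<^sup>2"
    unfolding norm_l2_sq by (intro suminf_le_const summable_l2)
  then show ?thesis
    using C by (rule power2_le_imp_le)
qed

instance
proof
  fix x y z :: "'a l2" and r s :: real
  show "x + y + z = x + (y + z)" "x + y = y + x" "0 + x = x" "- x + x = 0" "x - y = x + - y"
    "r *\<^sub>R (x + y) = r *\<^sub>R x + r *\<^sub>R y" "(r + s) *\<^sub>R x = r *\<^sub>R x + s *\<^sub>R x"
    "r *\<^sub>R s *\<^sub>R x = (r * s) *\<^sub>R x" "1 *\<^sub>R x = x"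
    by (rule l2_eqI, simp add: l2_nth_zero l2_nth_add l2_nth_uminus l2_nth_diff l2_nth_scaleR
        algebra_simps)+
  show "dist x y = norm (x - y)" "sgn x = inverse (norm x) *\<^sub>R x"
    by (simp_all add: dist_l2_def sgn_l2_def)
  show "uniformity = (INF e\<in>{0<..}. principal {(x, y :: 'a l2). dist x y < e})"
    by (rule uniformity_l2_def)
  show "open U \<longleftrightarrow> (\<forall>x\<in>U. \<forall>\<^sub>F (x', y) in uniformity. x' = x \<longrightarrow> y \<in> U)" for U :: "'a l2 set"
    by (rule open_l2_def)
  show "norm x = 0 \<longleftrightarrow> x = 0"
  proof -
    have "norm x = 0 \<longleftrightarrow> (\<forall>n. (norm (l2_nth x n))\<^sup>2 = 0)"
      unfolding norm_l2_def by (simp add: suminf_eq_zero_iff summable_l2)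
    then show ?thesis
      by (auto simp: l2_nth_zero intro!: l2_eqI)
  qed
  show "norm (x + y) \<le> norm x + norm y"
  proof (rule norm_l2_leI)
    fix N
    have "L2_set (\<lambda>n. norm (l2_nth (x + y) n)) {..<N}
        \<le> L2_set (\<lambda>n. norm (l2_nth x n) + norm (l2_nth y n)) {..<N}"
      by (intro L2_set_mono) (auto simp: l2_nth_add norm_triangle_ineq)
    also have "\<dots> \<le> L2_set (\<lambda>n. norm (l2_nth x n)) {..<N} + L2_set (\<lambda>n. norm (l2_nth y n)) {..<N}"
      by (rule L2_set_triangle_ineq)
    also have "\<dots> \<le> norm x + norm y"
      by (intro add_mono L2_set_le_norm_l2)
    finally show "L2_set (\<lambda>n. norm (l2_nth (x + y) n)) {..<N} \<le> norm x + norm y" .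
  qed
  show "norm (r *\<^sub>R x) = \<bar>r\<bar> * norm x"
    unfolding norm_l2_def
    by (simp add: l2_nth_scaleR power_mult_distrib suminf_mult summable_l2 real_sqrt_mult)
qed

end

lemma norm_l2_nth_le: "norm (l2_nth x n) \<le> norm x"
proof -
  have "(norm (l2_nth x n))\<^sup>2 \<le> (norm x)\<^sup>2"
    unfolding norm_l2_sq using sum_le_suminf[OF summable_l2[of x], of "{n}"] by simp
  then show ?thesis
    by (rule power2_le_imp_le) simp
qed

instance l2 :: (complex_hilbert_space) banach
proof
  fix X :: "nat \<Rightarrow> 'a l2"
  assume X: "Cauchy X"
  have "Cauchy (\<lambda>i. l2_nth (X i) n)" for n
    unfolding Cauchy_def
  proof (intro allI impI)
    fix e :: real assume "e > 0"
    then obtain M where M: "\<And>i j. i \<ge> M \<Longrightarrow> j \<ge> M \<Longrightarrow> dist (X i) (X j) < e"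
      using X unfolding Cauchy_def by blast
    have "dist (l2_nth (X i) n) (l2_nth (X j) n) < e" if "i \<ge> M" "j \<ge> M" for i j
      using M[OF that] norm_l2_nth_le[of "X i - X j" n] by (simp add: dist_norm l2_nth_diff)
    then show "\<exists>M. \<forall>i\<ge>M. \<forall>j\<ge>M. dist (l2_nth (X i) n) (l2_nth (X j) n) < e"
      by blast
  qed
  then have "\<exists>l. (\<lambda>i. l2_nth (X i) n) \<longlonglongrightarrow> l" for n
    using Cauchy_convergent convergent_def by blast
  then obtain y where y: "\<And>n. (\<lambda>i. l2_nth (X i) n) \<longlonglongrightarrow> y n"
    by metis
  have bound: "L2_set (\<lambda>n. norm (l2_nth (X i) n - y n)) {..<N} \<le> e"
    if M: "\<And>i j. i \<ge> M \<Longrightarrow> j \<ge> M \<Longrightarrow> dist (X i) (X j) < e" and "i \<ge> M" for e M i N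
  proof (rule tendsto_upperbound)
    show "(\<lambda>j. L2_set (\<lambda>n. norm (l2_nth (X i) n - l2_nth (X j) n)) {..<N})
        \<longlonglongrightarrow> L2_set (\<lambda>n. norm (l2_nth (X i) n - y n)) {..<N}"
      unfolding L2_set_def by (intro tendsto_intros y)
    show "\<forall>\<^sub>F j in sequentially. L2_set (\<lambda>n. norm (l2_nth (X i) n - l2_nth (X j) n)) {..<N} \<le> e"
      using eventually_ge_at_top[of M]
    proof eventually_elim
      case (elim j)
      show ?case
        using M[OF \<open>i \<ge> M\<close> elim] L2_set_le_norm_l2[of "X i - X j" N]
        by (simp add: l2_nth_diff dist_norm)
    qed
  qed simp
  have diff: "summable (\<lambda>n. (norm (l2_nth (X i) n - y n))\<^sup>2)"
    if M: "\<And>i j. i \<ge> M \<Longrightarrow> j \<ge> M \<Longrightarrow> dist (X i) (X j) < e" and "i \<ge> M" for e M i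
  proof (rule summableI_nonneg_bounded)
    show "(\<Sum>n<N. (norm (l2_nth (X i) n - y n))\<^sup>2) \<le> e\<^sup>2" for N
      using bound[OF M \<open>i \<ge> M\<close>, of N] unfolding L2_set_def by (simp add: sqrt_le_D)
  qed simp
  obtain M1 where M1: "\<And>i j. i \<ge> M1 \<Longrightarrow> j \<ge> M1 \<Longrightarrow> dist (X i) (X j) < 1"
    using X unfolding Cauchy_def by (meson zero_less_one)
  have "summable (\<lambda>n. (norm (l2_nth (X M1) n + - (l2_nth (X M1) n - y n)))\<^sup>2)"
    by (rule summable_l2_add) (use summable_l2 diff[OF M1 order_refl] in \<open>simp_all add: norm_minus_commute\<close>)
  then have Y: "l2_nth (Abs_l2 y) = y"
    by (simp add: l2_nth_Abs)
  have "X \<longlonglongrightarrow> Abs_l2 y"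
    unfolding lim_sequentially
  proof (intro allI impI)
    fix e :: real assume "e > 0"
    then obtain M where M: "\<And>i j. i \<ge> M \<Longrightarrow> j \<ge> M \<Longrightarrow> dist (X i) (X j) < e / 2"
      using X unfolding Cauchy_def by (meson half_gt_zero)
    have "norm (X i - Abs_l2 y) \<le> e / 2" if "i \<ge> M" for i
      by (rule norm_l2_leI) (use bound[OF M that] in \<open>simp add: l2_nth_diff Y\<close>)
    then show "\<exists>M. \<forall>i\<ge>M. dist (X i) (Abs_l2 y) < e"
      using \<open>e > 0\<close> by (intro exI[of _ M]) (force simp: dist_norm)
  qed
  then show "convergent X"
    by (auto simp: convergent_def)
qed

instantiation l2 :: (complex_hilbert_space) complex_hilbert_space
begin

definition "c *\<^sub>C x = Abs_l2 (\<lambda>n. c *\<^sub>C l2_nth x n)"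
definition "cinner x y = (\<Sum>n. cinner (l2_nth x n) (l2_nth y n))"

lemma l2_nth_scaleC: "l2_nth (c *\<^sub>C x :: 'a l2) n = c *\<^sub>C l2_nth x n"
  by (simp add: scaleC_l2_def l2_nth_Abs summable_l2 norm_scaleC power_mult_distrib summable_mult)

lemma summable_cinner_l2: "summable (\<lambda>n. cinner (l2_nth x n) (l2_nth (y :: 'a l2) n))"
proof (rule summable_comparison_test')
  show "summable (\<lambda>n. (norm (l2_nth x n))\<^sup>2 + (norm (l2_nth y n))\<^sup>2)"
    by (intro summable_add summable_l2)
  show "norm (cinner (l2_nth x n) (l2_nth y n)) \<le> (norm (l2_nth x n))\<^sup>2 + (norm (l2_nth y n))\<^sup>2"
    if "n \<ge> 0" for n
    using norm_cinner_le[of "l2_nth x n" "l2_nth y n"] norm_ge_zero[of "cinner (l2_nth x n) (l2_nth y n)"]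
    by linarith
qed

instance
proof
  fix x y z :: "'a l2" and c d :: complex and r :: real
  show "c *\<^sub>C (x + y) = c *\<^sub>C x + c *\<^sub>C y" "(c + d) *\<^sub>C x = c *\<^sub>C x + d *\<^sub>C x"
    "c *\<^sub>C d *\<^sub>C x = (c * d) *\<^sub>C x" "r *\<^sub>R x = complex_of_real r *\<^sub>C x"
    by (rule l2_eqI, simp add: l2_nth_add l2_nth_scaleC l2_nth_scaleR scaleC_add_right
        scaleC_add_left scaleC_scaleC scaleR_scaleC)+
  have "(\<lambda>n. cnj (cinner (l2_nth y n) (l2_nth x n))) sums cnj (cinner y x)"
    unfolding cinner_l2_def sums_cnj by (rule summable_sums[OF summable_cinner_l2])
  then show "cinner x y = cnj (cinner y x)"
    unfolding cinner_l2_def by (simp add: sums_iff flip: cinner_commute)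
  show "cinner (x + y) z = cinner x z + cinner y z"
    unfolding cinner_l2_def
    by (simp add: l2_nth_add cinner_add_left suminf_add summable_cinner_l2)
  show "cinner (c *\<^sub>C x) y = c * cinner x y"
    unfolding cinner_l2_def
    by (simp add: l2_nth_scaleC cinner_scaleC_left suminf_mult summable_cinner_l2)
  show "cinner x x = complex_of_real ((norm x)\<^sup>2)"
    unfolding cinner_l2_def norm_l2_sq
    by (simp add: cinner_self suminf_of_real summable_l2 del: of_real_power)
qed

end

section \<open>Bounded operators\<close>

definition bounded_clinear :: "('a :: complex_hilbert_space \<Rightarrow> 'b :: complex_hilbert_space) \<Rightarrow> bool"
  where "bounded_clinear T \<longleftrightarrow> bounded_linear T \<and> (\<forall>c x. T (c *\<^sub>C x) = c *\<^sub>C T x)"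

definition invertible_op :: "('a :: complex_hilbert_space \<Rightarrow> 'a) \<Rightarrow> bool"
  where "invertible_op T \<longleftrightarrow>
    bounded_clinear T \<and> (\<exists>S. bounded_clinear S \<and> S \<circ> T = id \<and> T \<circ> S = id)"

definition spectrum :: "('a :: complex_hilbert_space \<Rightarrow> 'a) \<Rightarrow> complex set"
  where "spectrum T = {z. \<not> invertible_op (\<lambda>x. T x - z *\<^sub>C x)}"

definition spectral_radius :: "('a :: complex_hilbert_space \<Rightarrow> 'a) \<Rightarrow> real"
  where "spectral_radius T = (SUP z\<in>spectrum T. cmod z)"

definition lower_bound :: "('a :: complex_hilbert_space \<Rightarrow> 'a) \<Rightarrow> real"
  where "lower_bound T = (INF x\<in>{x. norm x = 1}. norm (T x))"

text \<open>The limit exists for every bounded operator \<open>T\<close> on a non-zero space, since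
  \<open>lower_bound (T ^^ (j + k)) \<ge> lower_bound (T ^^ j) * lower_bound (T ^^ k)\<close>.\<close>

definition lower_radius :: "('a :: complex_hilbert_space \<Rightarrow> 'a) \<Rightarrow> real"
  where "lower_radius T = lim (\<lambda>n. root n (lower_bound (T ^^ n)))"

section \<open>Bishop's property (beta)\<close>

text \<open>Analytic functions on \<open>U\<close> are represented by their extension to the whole plane that is
  \<open>undefined\<close> outside \<open>U\<close>, so that equality is equality on \<open>U\<close>.\<close>

definition analytic_functions :: "complex set \<Rightarrow> (complex \<Rightarrow> 'a :: complex_hilbert_space) set"
  where "analytic_functions U = {f \<in> extensional U.
    \<forall>z\<in>U. \<exists>f'. (f has_derivative (\<lambda>h. h *\<^sub>C f')) (at z within U)}"

text \<open>The topology of uniform convergence on compact subsets of \<open>U\<close>.\<close>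

definition analytic_topology :: "complex set \<Rightarrow> (complex \<Rightarrow> 'a :: complex_hilbert_space) topology"
  where "analytic_topology U = topology (\<lambda>V. V \<subseteq> analytic_functions U \<and>
    (\<forall>f\<in>V. \<exists>K e. compact K \<and> K \<subseteq> U \<and> 0 < e \<and>
      (\<forall>g\<in>analytic_functions U. (\<forall>z\<in>K. norm (g z - f z) < e) \<longrightarrow> g \<in> V)))"

lemma openin_analytic_topology:
  fixes V :: "(complex \<Rightarrow> 'a :: complex_hilbert_space) set"
  shows "openin (analytic_topology U) V \<longleftrightarrow> V \<subseteq> analytic_functions U \<and>
    (\<forall>f\<in>V. \<exists>K e. compact K \<and> K \<subseteq> U \<and> 0 < e \<and>
      (\<forall>g\<in>analytic_functions U. (\<forall>z\<in>K. norm (g z - f z) < e) \<longrightarrow> g \<in> V))"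
proof -
  let ?P = "\<lambda>V :: (complex \<Rightarrow> 'a) set. V \<subseteq> analytic_functions U \<and>
    (\<forall>f\<in>V. \<exists>K e. compact K \<and> K \<subseteq> U \<and> 0 < e \<and>
      (\<forall>g\<in>analytic_functions U. (\<forall>z\<in>K. norm (g z - f z) < e) \<longrightarrow> g \<in> V))"
  have "istopology ?P"
    unfolding istopology_def
  proof (intro conjI allI impI)
    fix S T :: "(complex \<Rightarrow> 'a) set" assume S: "?P S" and T: "?P T"
    show "S \<inter> T \<subseteq> analytic_functions U"
      using S by blast
    show "\<forall>f\<in>S \<inter> T. \<exists>K e. compact K \<and> K \<subseteq> U \<and> 0 < e \<and>
      (\<forall>g\<in>analytic_functions U. (\<forall>z\<in>K. norm (g z - f z) < e) \<longrightarrow> g \<in> S \<inter> T)"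
    proof
      fix f assume f: "f \<in> S \<inter> T"
      obtain K d where K: "compact K" "K \<subseteq> U" "0 < d"
        "\<forall>g\<in>analytic_functions U. (\<forall>z\<in>K. norm (g z - f z) < d) \<longrightarrow> g \<in> S"
        using S f by blast
      obtain L e where L: "compact L" "L \<subseteq> U" "0 < e"
        "\<forall>g\<in>analytic_functions U. (\<forall>z\<in>L. norm (g z - f z) < e) \<longrightarrow> g \<in> T"
        using T f by blast
      show "\<exists>K e. compact K \<and> K \<subseteq> U \<and> 0 < e \<and>
        (\<forall>g\<in>analytic_functions U. (\<forall>z\<in>K. norm (g z - f z) < e) \<longrightarrow> g \<in> S \<inter> T)"
        using K L by (intro exI[of _ "K \<union> L"] exI[of _ "min d e"]) auto
    qed
  next
    fix \<V> :: "(complex \<Rightarrow> 'a) set set" assume "\<forall>V\<in>\<V>. ?P V"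
    then show "\<Union>\<V> \<subseteq> analytic_functions U"
      and "\<forall>f\<in>\<Union>\<V>. \<exists>K e. compact K \<and> K \<subseteq> U \<and> 0 < e \<and>
        (\<forall>g\<in>analytic_functions U. (\<forall>z\<in>K. norm (g z - f z) < e) \<longrightarrow> g \<in> \<Union>\<V>)"
      by (blast, fast)
  qed
  then show ?thesis
    by (simp add: analytic_topology_def topology_inverse')
qed

definition bishop_map :: "('a :: complex_hilbert_space \<Rightarrow> 'a) \<Rightarrow> complex set \<Rightarrow> (complex \<Rightarrow> 'a) \<Rightarrow> complex \<Rightarrow> 'a"
  where "bishop_map T U f = (\<lambda>z\<in>U. T (f z) - z *\<^sub>C f z)"

definition property_beta :: "('a :: complex_hilbert_space \<Rightarrow> 'a) \<Rightarrow> bool"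
  where "property_beta T \<longleftrightarrow> (\<forall>U. open U \<longrightarrow>
    inj_on (bishop_map T U) (analytic_functions U) \<and>
    closedin (analytic_topology U) (bishop_map T U ` analytic_functions U))"

section \<open>Unilateral operator weighted shifts\<close>

definition unilateral_shift :: "(nat \<Rightarrow> 'a :: complex_hilbert_space \<Rightarrow> 'a) \<Rightarrow> 'a l2 \<Rightarrow> 'a l2"
  where "unilateral_shift A x =
    Abs_l2 (\<lambda>n. case n of 0 \<Rightarrow> 0 | Suc k \<Rightarrow> A k (l2_nth x k))"

primrec weight_product :: "(nat \<Rightarrow> 'a \<Rightarrow> 'a) \<Rightarrow> nat \<Rightarrow> 'a \<Rightarrow> 'a" where
  "weight_product A 0 = id"
| "weight_product A (Suc n) = A n \<circ> weight_product A n"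

text \<open>Boundedness of the weights makes the sequence in the definition of the shift square summable.\<close>

lemma l2_nth_unilateral_shift:
  assumes "\<And>n. bounded_clinear (A n)" and "bdd_above (range (\<lambda>n. onorm (A n)))"
  shows "l2_nth (unilateral_shift A x) n = (case n of 0 \<Rightarrow> 0 | Suc k \<Rightarrow> A k (l2_nth x k))"
proof -
  obtain M where M: "\<And>n. onorm (A n) \<le> M"
    using assms(2) by (auto simp: bdd_above_def)
  have "norm (A k (l2_nth x k)) \<le> M * norm (l2_nth x k)" for k
  proof -
    have "norm (A k (l2_nth x k)) \<le> onorm (A k) * norm (l2_nth x k)"
      using assms(1) by (intro onorm) (simp add: bounded_clinear_def)
    also have "\<dots> \<le> M * norm (l2_nth x k)"
      by (intro mult_right_mono M) simp
    finally show ?thesis .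
  qed
  then have "summable (\<lambda>k. (norm (A k (l2_nth x k)))\<^sup>2)"
    by (rule summable_l2_bounded[OF summable_l2])
  then have "summable (\<lambda>n. (norm (case n of 0 \<Rightarrow> 0 | Suc k \<Rightarrow> A k (l2_nth x k)))\<^sup>2)"
    by (subst summable_Suc_iff[symmetric]) simp
  then show ?thesis
    by (simp add: unilateral_shift_def l2_nth_Abs)
qed

text \<open>In \<^typ>\<open>ereal\<close> one has \<open>1 / \<infinity> = 0\<close>.\<close>

definition r2_shift :: "(nat \<Rightarrow> 'a :: complex_hilbert_space \<Rightarrow> 'a) \<Rightarrow> ereal"
  where "r2_shift A = 1 / limsup (\<lambda>n. ereal (root n (onorm (inv (weight_product A n)))))"

definition R3_plus_shift :: "(nat \<Rightarrow> 'a :: complex_hilbert_space \<Rightarrow> 'a) \<Rightarrow> ereal"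
  where "R3_plus_shift A =
    (SUP x\<in>{x. x \<noteq> 0}. limsup (\<lambda>n. ereal (root n (norm (weight_product A n x)))))"

end

theory Submission
  imports Defs
begin

text \<open>
  Let \<open>T\<close> be the shift and \<open>W k j = A (k + j - 1) \<circ> \<dots> \<circ> A k\<close>, so that \<open>T ^^ j\<close> carries a vector \<open>x\<close>
  in coordinate \<open>k\<close> to \<open>W k j x\<close> in coordinate \<open>k + j\<close>, and \<open>B n = W 0 n\<close>. Property (beta) is used
  only to show that the growth of an orbit over a long stretch controls its growth over every
  initial and every final piece of that stretch, with constants that do not depend on the orbit.

  The Laurent polynomial \<open>f z = (\<Sum>j\<le>N. z powi (p - j) *\<^sub>C T ^^ j (single k x))\<close> contains a whole stretch of
  the orbit, whereas \<open>(T - z) f z\<close> telescopes to the two end terms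
  \<open>z powi (p - N) *\<^sub>C T ^^ (N + 1) (single k x) - z powi (p + 1) *\<^sub>C single k x\<close>. The open mapping
  theorem for the map \<open>f \<mapsto> (T - z) f\<close> on an annulus \<open>s < \<bar>z\<bar> < \<rho>\<close> would bound \<open>f\<close> at a
  point \<open>\<tau>\<close> of the annulus by \<open>(T - z) f\<close>. For a shift there is a shorter way to this bound: since
  each coordinate of a solution \<open>y\<close> of \<open>(T - \<tau>) y = h\<close> depends continuously on finitely many
  coordinates of \<open>h\<close>, a sequence of counterexamples could be
  superposed to a gliding hump \<open>(T - z) F\<close>, which lies in the closed range although the coordinates of
  \<open>F \<tau>\<close> would be unbounded (\<open>gliding_hump\<close>, \<open>orbit_sum_series\<close>, \<open>orbit_estimate\<close>). The exponents
  \<open>p = -1\<close> and \<open>p = N\<close> give, for \<open>s < \<tau> < \<rho>\<close> and \<open>j < n\<close>,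

    \<^item> \<open>norm (W k j x) \<le> C * \<tau> ^ j * (norm x + norm (W k n x) / s ^ n)\<close> (\<open>orbit_upper_estimate\<close>);
    \<^item> \<open>\<tau> ^ (n - j) * norm (W k j x) \<le> C * (norm (W k n x) + \<rho> ^ n * norm x)\<close> (\<open>orbit_lower_estimate\<close>).

  The three assertions follow from these inequalities. If every \<open>norm (W 0 n y)\<close> grows more slowly than
  \<open>s ^ n\<close>, then the first inequality, as \<open>n\<close> tends to infinity, bounds all powers of \<open>T\<close>, so
  the spectral radius is at most the local growth rate \<open>R\<^sub>3\<^sup>+\<close>; conversely, solving
  \<open>(T - z) y = single 0 x\<close> coordinate by coordinate shows that the growth rate of \<open>x\<close> is at most \<open>\<bar>z\<bar>\<close>
  whenever \<open>z\<close> is a non-zero point outside the spectrum. If \<open>B n\<close> is bounded below by \<open>\<rho> ^ n\<close>,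
  then the second inequality, applied to orbits that start in coordinate \<open>0\<close>, bounds \<open>T ^^ n\<close>
  below by a multiple of \<open>\<tau> ^ n\<close>; if not, then the first inequality bounds \<open>m(T ^^ n)\<close> above. This
  identifies \<open>r\<^sub>1\<close> and \<open>r\<^sub>2\<close>. The same two arguments for one orbit show that its infimal and its supremal
  ratios have the exponential growth rate of the orbit itself.
\<close>

section \<open>Laurent series with vector coefficients\<close>

lemma bounded_bilinear_scaleC:
  "bounded_bilinear (scaleC :: complex \<Rightarrow> 'a \<Rightarrow> 'a :: complex_hilbert_space)"
proof
  show "\<exists>K. \<forall>c (x :: 'a). norm (c *\<^sub>C x) \<le> norm c * norm x * K"
    by (rule exI[of _ 1]) (simp add: norm_scaleC)
qed (simp_all add: scaleC_add_left scaleC_add_right scaleR_scaleC scaleC_scaleC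
    scaleR_conv_of_real mult.commute)

interpretation scaleC: bounded_bilinear "scaleC :: complex \<Rightarrow> 'a \<Rightarrow> 'a :: complex_hilbert_space"
  by (rule bounded_bilinear_scaleC)

declare scaleC.zero_left [simp] scaleC.zero_right [simp]

lemma scaleC_one [simp]: "1 *\<^sub>C x = (x :: 'a :: complex_hilbert_space)"
  using scaleR_scaleC[of 1 x] by simp

text \<open>An integer power is monotone or antitone on the positive reals, so on an interval it is at most
  the sum of its values at the end points. This treats both signs of the exponent alike.\<close>
lemma powi_le_endpoints:
  fixes s t \<rho> :: real
  assumes "0 < s" "s \<le> t" "t \<le> \<rho>"
  shows "t powi q \<le> s powi q + \<rho> powi q"
proof (cases "q \<ge> 0")
  case True
  then have "t powi q \<le> \<rho> powi q"
    using assms by (intro power_int_mono) auto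
  then show ?thesis
    using assms by (simp add: add_increasing)
next
  case False
  then have "t powi q \<le> s powi q"
    using assms by (intro power_int_antimono) auto
  then show ?thesis
    using assms by (simp add: add_increasing2)
qed

lemma power_deriv_le:
  fixes u d :: real
  assumes "0 \<le> u" "0 \<le> d"
  shows "of_nat m * u ^ (m - 1) * d \<le> (u + d) ^ m"
proof (induction m)
  case (Suc m)
  have "of_nat (Suc m) * u ^ m * d = u * (of_nat m * u ^ (m - 1) * d) + d * u ^ m"
    by (cases m) (simp_all add: algebra_simps)
  also have "\<dots> \<le> u * (u + d) ^ m + d * (u + d) ^ m"
    using assms Suc.IH by (intro add_mono mult_left_mono power_mono) auto
  finally show ?case
    by (simp add: algebra_simps)
qed simp

text \<open>A substitute for Cauchy's estimate: the derivative of a power at \<open>t\<close> is controlled by the power itself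
  at distance \<open>d\<close>. By the binomial theorem \<open>(u + d) ^ m\<close> exceeds its term \<open>m * u ^ (m - 1) * d\<close>;
  for negative exponents the same inequality is applied at \<open>u = t - d\<close>.\<close>
lemma powi_deriv_le_endpoints:
  fixes s t d \<rho> :: real
  assumes "0 < s" "0 < d" "s \<le> t - d" "t + d \<le> \<rho>"
  shows "\<bar>of_int q\<bar> * t powi (q - 1) \<le> (s powi q + \<rho> powi q) / d"
proof -
  have "\<bar>of_int q\<bar> * t powi (q - 1) * d \<le> s powi q + \<rho> powi q"
  proof (cases "q \<ge> 0")
    case True
    then obtain n where n: "q = int n"
      using zero_le_imp_eq_int by blast
    have "\<bar>of_int q\<bar> * t powi (q - 1) * d = of_nat n * t ^ (n - 1) * d"
      by (cases n) (simp_all add: n)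
    also have "\<dots> \<le> (t + d) ^ n"
      using assms by (intro power_deriv_le) auto
    also have "\<dots> = (t + d) powi q"
      by (simp add: n)
    also have "\<dots> \<le> s powi q + \<rho> powi q"
      using assms by (intro powi_le_endpoints) auto
    finally show ?thesis .
  next
    case False
    define n where "n = nat (- q)"
    then have n: "q = - int n"
      using False by simp
    let ?u = "t - d"
    have u: "?u > 0" "t > 0"
      using assms by auto
    have "of_nat n * ?u ^ n * d \<le> of_nat (Suc n) * ?u ^ n * d"
      using u assms by (intro mult_right_mono) auto
    also have "\<dots> \<le> t ^ Suc n"
      using power_deriv_le[of ?u d "Suc n"] u assms by simp
    finally have "of_nat n * d / t ^ Suc n \<le> 1 / ?u ^ n"
      using u by (simp add: field_simps del: power_Suc)
    moreover have "t powi (q - 1) = 1 / t ^ Suc n"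
    proof -
      have "q - 1 = - int (Suc n)"
        by (simp add: n)
      then show ?thesis
        by (simp only: power_int_minus power_int_of_nat inverse_eq_divide)
    qed
    ultimately have "\<bar>of_int q\<bar> * t powi (q - 1) * d \<le> ?u powi q"
      by (simp add: n power_int_minus inverse_eq_divide)
    also have "\<dots> \<le> s powi q + \<rho> powi q"
      using assms by (intro powi_le_endpoints) auto
    finally show ?thesis .
  qed
  then show ?thesis
    using assms by (simp add: pos_le_divide_eq)
qed

text \<open>The smallness hypothesis bounds the terms uniformly on the open annulus. By
  \<open>powi_deriv_le_endpoints\<close> it also bounds their derivatives uniformly on a small disc about each
  point, so the series may be differentiated term by term.\<close>
lemma
  fixes v :: "nat \<Rightarrow> 'a :: complex_hilbert_space" and q :: "nat \<Rightarrow> int"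
  assumes s: "0 < s"
    and small: "\<And>m. (s powi q m + \<rho> powi q m) * norm (v m) \<le> (1/2) ^ m"
  shows norm_laurent_term_le:
      "\<And>z m. \<lbrakk>s < cmod z; cmod z < \<rho>\<rbrakk> \<Longrightarrow> norm ((z powi q m) *\<^sub>C v m) \<le> (1/2) ^ m"
    and laurent_series_differentiable:
      "\<And>z. \<lbrakk>s < cmod z; cmod z < \<rho>\<rbrakk> \<Longrightarrow>
        \<exists>f'. ((\<lambda>z. \<Sum>m. (z powi q m) *\<^sub>C v m) has_derivative (\<lambda>h. h *\<^sub>C f')) (at z)"
proof -
  show bound: "norm ((z powi q m) *\<^sub>C v m) \<le> (1/2) ^ m" if "s < cmod z" "cmod z < \<rho>" for z m
  proof -
    have "norm ((z powi q m) *\<^sub>C v m) = cmod z powi q m * norm (v m)"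
      by (simp add: norm_scaleC norm_power_int)
    also have "\<dots> \<le> (s powi q m + \<rho> powi q m) * norm (v m)"
      using s that by (intro mult_right_mono powi_le_endpoints) auto
    finally show ?thesis
      using small[of m] by (rule order_trans)
  qed
  fix z assume z: "s < cmod z" "cmod z < \<rho>"
  define d where "d = min (cmod z - s) (\<rho> - cmod z) / 2"
  have d: "d > 0" "s + 2 * d \<le> cmod z" "cmod z + 2 * d \<le> \<rho>"
    using z by (auto simp: d_def)
  define S where "S = ball z d"
  have S: "s \<le> cmod w - d" "cmod w + d \<le> \<rho>" "w \<noteq> 0" if "w \<in> S" for w
  proof -
    have "dist z w < d"
      using that by (simp add: S_def)
    then have "\<bar>cmod z - cmod w\<bar> < d"
      using norm_triangle_ineq3[of z w] by (simp add: dist_norm)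
    then show "s \<le> cmod w - d" "cmod w + d \<le> \<rho>" "w \<noteq> 0"
      using d s by auto
  qed
  define e where "e m w = (of_int (q m) * w powi (q m - 1)) *\<^sub>C v m" for m and w :: complex
  have e: "norm (e m w) \<le> (1/2) ^ m / d" if "w \<in> S" for m w
  proof -
    have "norm (e m w) = \<bar>of_int (q m)\<bar> * cmod w powi (q m - 1) * norm (v m)"
      by (simp add: e_def norm_scaleC norm_mult norm_power_int)
    also have "\<dots> \<le> (s powi q m + \<rho> powi q m) / d * norm (v m)"
      using s d S[OF that] by (intro mult_right_mono powi_deriv_le_endpoints) auto
    also have "\<dots> \<le> (1/2) ^ m / d"
      using small[of m] d by (simp add: divide_right_mono)
    finally show ?thesis .
  qed
  have ul: "uniform_limit S (\<lambda>n w. \<Sum>i<n. e i w) (\<lambda>w. \<Sum>i. e i w) sequentially"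
    using e by (rule Weierstrass_m_test) (auto intro: summable_divide summable_geometric)
  have "\<exists>g. \<forall>w\<in>S. (\<lambda>m. (w powi q m) *\<^sub>C v m) sums g w \<and>
      (g has_derivative (\<lambda>h. h *\<^sub>C (\<Sum>m. e m w))) (at w within S)"
  proof (rule has_derivative_series[where f' = "\<lambda>m w h. h *\<^sub>C e m w"])
    show "convex S" "z \<in> S"
      using d by (simp_all add: S_def)
    show "((\<lambda>w. (w powi q m) *\<^sub>C v m) has_derivative (\<lambda>h. h *\<^sub>C e m w)) (at w within S)"
      if "w \<in> S" for m w
    proof -
      have "((\<lambda>w. w powi q m) has_derivative (\<lambda>h. h * (of_int (q m) * w powi (q m - 1)))) (at w within S)"
        using S(3)[OF that] by (rule has_derivative_power_int')
      from bounded_linear.has_derivative[OF scaleC.bounded_linear_left[of "v m"] this]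
      show ?thesis
        by (simp add: e_def scaleC_scaleC)
    qed
    show "\<forall>\<^sub>F n in sequentially. \<forall>w\<in>S. \<forall>h. norm ((\<Sum>i<n. h *\<^sub>C e i w) - h *\<^sub>C (\<Sum>m. e m w)) \<le> \<epsilon> * norm h"
      if "\<epsilon> > 0" for \<epsilon>
      using uniform_limitD[OF ul that]
    proof eventually_elim
      case (elim n)
      show ?case
      proof (intro ballI allI)
        fix w h assume "w \<in> S"
        have "norm ((\<Sum>i<n. h *\<^sub>C e i w) - h *\<^sub>C (\<Sum>m. e m w))
            = norm h * dist (\<Sum>i<n. e i w) (\<Sum>m. e m w)"
          unfolding dist_norm norm_scaleC[symmetric] by (simp only: scaleC.sum_right scaleC.diff_right)
        also have "\<dots> \<le> norm h * \<epsilon>"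
          using elim \<open>w \<in> S\<close> by (intro mult_left_mono norm_ge_zero) (blast intro: less_imp_le)
        finally show "norm ((\<Sum>i<n. h *\<^sub>C e i w) - h *\<^sub>C (\<Sum>m. e m w)) \<le> \<epsilon> * norm h"
          by (simp only: mult.commute)
      qed
    qed
    show "(\<lambda>m. (z powi q m) *\<^sub>C v m) sums (\<Sum>m. (z powi q m) *\<^sub>C v m)"
      by (intro summable_sums summable_comparison_test'[OF _ bound[OF z]] summable_geometric) auto
  qed
  then obtain g where g: "\<And>w. w \<in> S \<Longrightarrow> (\<lambda>m. (w powi q m) *\<^sub>C v m) sums g w"
      "\<And>w. w \<in> S \<Longrightarrow> (g has_derivative (\<lambda>h. h *\<^sub>C (\<Sum>m. e m w))) (at w within S)"
    by blast
  have S': "open S" "z \<in> S"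
    using d by (simp_all add: S_def)
  have "(g has_derivative (\<lambda>h. h *\<^sub>C (\<Sum>m. e m z))) (at z)"
    using g(2)[OF S'(2)] unfolding at_within_open[OF S'(2,1)] .
  then have "((\<lambda>z. \<Sum>m. (z powi q m) *\<^sub>C v m) has_derivative (\<lambda>h. h *\<^sub>C (\<Sum>m. e m z))) (at z)"
    by (rule has_derivative_transform_within_open[OF _ S']) (rule sums_unique[OF g(1)])
  then show "\<exists>f'. ((\<lambda>z. \<Sum>m. (z powi q m) *\<^sub>C v m) has_derivative (\<lambda>h. h *\<^sub>C f')) (at z)"
    by blast
qed

lemma restrict_in_analytic_functions:
  assumes "\<And>z. z \<in> U \<Longrightarrow> \<exists>f'. (f has_derivative (\<lambda>h. h *\<^sub>C f')) (at z within U)"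
  shows "restrict f U \<in> analytic_functions U"
proof -
  have "\<exists>f'. (restrict f U has_derivative (\<lambda>h. h *\<^sub>C f')) (at z within U)" if z: "z \<in> U" for z
  proof -
    obtain f' where "(f has_derivative (\<lambda>h. h *\<^sub>C f')) (at z within U)"
      using assms[OF z] by blast
    then have "(restrict f U has_derivative (\<lambda>h. h *\<^sub>C f')) (at z within U)"
      by (rule has_derivative_transform[OF z, rotated]) simp
    then show ?thesis ..
  qed
  then show ?thesis
    by (simp add: analytic_functions_def)
qed

lemma complex_derivative_monomial:
  assumes "z \<noteq> 0"
  shows "\<exists>f'. ((\<lambda>z. (z powi q) *\<^sub>C v) has_derivative (\<lambda>h. h *\<^sub>C f')) (at z within U)"
proof -
  have "((\<lambda>w. (w powi q) *\<^sub>C v) has_derivative (\<lambda>h. (h * (of_int q * z powi (q - 1))) *\<^sub>C v)) (at z within U)"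
    by (rule bounded_linear.has_derivative[OF scaleC.bounded_linear_left[of v]
        has_derivative_power_int'[OF assms]])
  then show ?thesis
    unfolding scaleC_scaleC[symmetric] by blast
qed

lemma complex_derivative_sum:
  assumes "\<And>i. i \<in> I \<Longrightarrow> \<exists>f'. (f i has_derivative (\<lambda>h. h *\<^sub>C f')) F"
  shows "\<exists>f'. ((\<lambda>z. \<Sum>i\<in>I. f i z) has_derivative (\<lambda>h. h *\<^sub>C f')) F"
proof -
  obtain d where d: "\<And>i. i \<in> I \<Longrightarrow> (f i has_derivative (\<lambda>h. h *\<^sub>C d i)) F"
    using assms by metis
  have "((\<lambda>z. \<Sum>i\<in>I. f i z) has_derivative (\<lambda>h. \<Sum>i\<in>I. h *\<^sub>C d i)) F"
    by (rule has_derivative_sum) (rule d)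
  then show ?thesis
    unfolding scaleC.sum_right[symmetric] by blast
qed

lemma complex_derivative_diff:
  assumes "\<exists>f'. (f has_derivative (\<lambda>h. h *\<^sub>C f')) F" "\<exists>f'. (g has_derivative (\<lambda>h. h *\<^sub>C f')) F"
  shows "\<exists>f'. ((\<lambda>z. f z - g z) has_derivative (\<lambda>h. h *\<^sub>C f')) F"
proof -
  obtain c d where d: "(f has_derivative (\<lambda>h. h *\<^sub>C c)) F" "(g has_derivative (\<lambda>h. h *\<^sub>C d)) F"
    using assms by blast
  have "((\<lambda>z. f z - g z) has_derivative (\<lambda>h. h *\<^sub>C c - h *\<^sub>C d)) F"
    by (rule has_derivative_diff) (rule d)+
  then show ?thesis
    unfolding scaleC.diff_right[symmetric] by blast
qed

section \<open>The closed range along sequences\<close>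

text \<open>A function outside the closed range would have a whole neighbourhood outside it, and that
  neighbourhood contains \<open>bishop_map T U (F m)\<close> for large \<open>m\<close>.\<close>
lemma property_beta_closed_range:
  assumes beta: "property_beta T" and U: "open U"
    and F: "\<And>m. F m \<in> analytic_functions U" and g: "g \<in> analytic_functions U"
    and lim: "uniform_limit U (\<lambda>m. bishop_map T U (F m)) g sequentially"
  shows "\<exists>f\<in>analytic_functions U. bishop_map T U f = g"
proof (rule ccontr)
  let ?R = "bishop_map T U ` analytic_functions U"
  assume "\<not> ?thesis"
  then have "g \<notin> ?R"
    by auto
  have "openin (analytic_topology U) (analytic_functions U :: (complex \<Rightarrow> 'a) set)"
    unfolding openin_analytic_topology
    by (auto intro!: exI[of _ "{} :: complex set"] exI[of _ "1 :: real"])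
  then have top: "topspace (analytic_topology U) = (analytic_functions U :: (complex \<Rightarrow> 'a) set)"
    using openin_topspace[of "analytic_topology U :: (complex \<Rightarrow> 'a) topology"]
    unfolding openin_analytic_topology[of U "topspace _"]
    by (intro subset_antisym openin_subset) auto
  have "closedin (analytic_topology U) ?R"
    using beta U by (simp add: property_beta_def)
  then have sub: "?R \<subseteq> analytic_functions U"
    and "openin (analytic_topology U) (analytic_functions U - ?R)"
    by (simp_all add: closedin_def top)
  then have "\<forall>f\<in>analytic_functions U - ?R. \<exists>K e. compact K \<and> K \<subseteq> U \<and> 0 < e \<and>
      (\<forall>h\<in>analytic_functions U. (\<forall>z\<in>K. norm (h z - f z) < e) \<longrightarrow> h \<in> analytic_functions U - ?R)"
    unfolding openin_analytic_topology by (elim conjunct2)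
  from bspec[OF this, of g] g \<open>g \<notin> ?R\<close> obtain K e where K: "K \<subseteq> U" "e > 0"
      "\<And>h. h \<in> analytic_functions U \<Longrightarrow> \<forall>z\<in>K. norm (h z - g z) < e \<Longrightarrow> h \<in> analytic_functions U - ?R"
    by auto
  obtain m where "\<forall>z\<in>U. dist (bishop_map T U (F m) z) (g z) < e"
    using uniform_limitD[OF lim \<open>e > 0\<close>] by (auto simp: eventually_sequentially)
  then have "bishop_map T U (F m) \<in> analytic_functions U - ?R"
    using K F sub by (intro K(3)) (auto simp: dist_norm)
  then show False
    using F by auto
qed

section \<open>Uniform boundedness by a gliding hump\<close>

text \<open>The uniform boundedness principle in the form needed here: \<open>\<phi> i\<close> is a sequence of coordinates, \<open>a i\<close>
  its cost. Were there no common constant, one could choose \<open>s 0\<close>, \<open>s 1\<close> and so on, and coordinates \<open>N m\<close> one after the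
  other, so that \<open>\<phi> (s m)\<close> at \<open>N m\<close> dominates everything chosen before, while all later terms are too
  cheap to matter at \<open>N m\<close>, because a single coordinate is bounded by the cost. The sum of the series
  would then be unbounded along \<open>N\<close>.\<close>
lemma gliding_hump:
  fixes a :: "'i \<Rightarrow> real" and \<phi> :: "'i \<Rightarrow> nat \<Rightarrow> 'b :: banach"
  assumes scale: "\<And>i c. 0 < c \<Longrightarrow> \<exists>i'. a i' = c * a i \<and> (\<forall>n. \<phi> i' n = c *\<^sub>R \<phi> i n)"
    and nonneg: "\<And>i. 0 \<le> a i"
    and coord: "\<And>n. \<exists>D. \<forall>i. norm (\<phi> i n) \<le> D * a i"
    and bounded: "\<And>i. \<exists>E. \<forall>n. norm (\<phi> i n) \<le> E"
    and series: "\<And>s. (\<And>m. a (s m) \<le> (1/2) ^ m) \<Longrightarrow>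
      \<exists>y B. \<forall>n. norm (y n) \<le> B \<and> (\<lambda>m. \<phi> (s m) n) sums y n"
  shows "\<exists>C>0. \<forall>i n. norm (\<phi> i n) \<le> C * a i"
proof (rule ccontr)
  assume "\<not> ?thesis"
  then have big: "\<exists>i n. C * a i < norm (\<phi> i n)" if "C > 0" for C
    using that by (meson not_le)
  obtain D where D: "\<And>n i. norm (\<phi> i n) \<le> D n * a i"
    using coord by metis
  obtain E where E: "\<And>i n. norm (\<phi> i n) \<le> E i"
    using bounded by metis
  have E0: "0 \<le> E i" for i
    using E[of i 0] norm_ge_zero order_trans by blast
  \<comment> \<open>By homogeneity an element of any prescribed cost can have an arbitrarily large coordinate.\<close>
  have step: "\<exists>i n. a i = e \<and> R < norm (\<phi> i n)" if pos: "e > 0" "R > 0" for e R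
  proof -
    obtain i n where i: "R / e * a i < norm (\<phi> i n)"
      using big[OF divide_pos_pos[OF pos(2,1)]] by blast
    then have "a i \<noteq> 0"
      using D[of i n] by auto
    then have "a i > 0"
      using nonneg[of i] by simp
    moreover obtain i' where "a i' = e / a i * a i" "\<phi> i' n = (e / a i) *\<^sub>R \<phi> i n"
      using scale[of "e / a i" i] \<open>a i > 0\<close> \<open>e > 0\<close> by auto
    ultimately have "a i' = e" "norm (\<phi> i' n) > R"
      using i \<open>e > 0\<close> by (auto simp: field_simps)
    then show ?thesis by blast
  qed
  \<comment> \<open>The choice \<open>r\<close> at stage \<open>m\<close> consists of an index and the coordinate where its hump sits; it may
      depend on the earlier choices \<open>f l\<close>.\<close>
  define P where "P f m r \<longleftrightarrow> a (fst r) \<le> (1/2) ^ m \<and>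
      (\<forall>l<m. D (snd (f l)) * a (fst r) \<le> (1/2) ^ m) \<and>
      m + 2 + (\<Sum>l<m. E (fst (f l))) < norm (\<phi> (fst r) (snd r))"
    for f :: "nat \<Rightarrow> 'i \<times> nat" and m :: nat and r :: "'i \<times> nat"
  have "\<exists>f. \<forall>m. P f m (f m)"
  proof (rule dependent_wellorder_choice)
    show "P f m r = P g m r" if "\<And>l. l < m \<Longrightarrow> f l = g l" for r f g m
      using that by (simp add: P_def)
    fix m :: nat and f :: "nat \<Rightarrow> 'i \<times> nat"
    define K where "K = 1 + (\<Sum>l<m. \<bar>D (snd (f l))\<bar>)"
    have "K \<ge> 1"
      by (simp add: K_def sum_nonneg)
    have DK: "D (snd (f l)) \<le> K" if "l < m" for l
      using member_le_sum[of l "{..<m}" "\<lambda>l. \<bar>D (snd (f l))\<bar>"] that by (simp add: K_def)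
    obtain i n where i: "a i = (1/2) ^ m / K" "m + 2 + (\<Sum>l<m. E (fst (f l))) < norm (\<phi> i n)"
      using step[of "(1/2) ^ m / K" "m + 2 + (\<Sum>l<m. E (fst (f l)))"] \<open>K \<ge> 1\<close> E0
      by (auto simp: sum_nonneg add_nonneg_pos add_pos_nonneg)
    have "a i \<le> (1/2) ^ m"
      using \<open>K \<ge> 1\<close> by (simp add: i(1) divide_le_eq mult_le_cancel_left1)
    moreover have "D (snd (f l)) * a i \<le> (1/2) ^ m" if "l < m" for l
      using mult_right_mono[OF DK[OF that] nonneg[of i]] \<open>K \<ge> 1\<close> by (simp add: i(1))
    ultimately have "P f m (i, n)"
      using i(2) by (simp add: P_def)
    then show "\<exists>r. P f m r" ..
  qed
  then obtain f where f: "\<And>m. P f m (f m)"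
    by blast
  define s N where "s m = fst (f m)" and "N m = snd (f m)" for m
  have small: "a (s m) \<le> (1/2) ^ m" for m
    using f[of m] by (simp add: P_def s_def)
  have later: "norm (\<phi> (s m) (N l)) \<le> (1/2) ^ m" if "l < m" for l m
    using f[of m] that D[of "s m" "N l"] by (force simp: P_def s_def N_def)
  have hump: "m + 2 + (\<Sum>l<m. E (s l)) < norm (\<phi> (s m) (N m))" for m
    using f[of m] by (simp add: P_def s_def N_def)
  obtain y B where y: "\<And>n. norm (y n) \<le> B" "\<And>n. (\<lambda>m. \<phi> (s m) n) sums y n"
    using series[OF small] by blast
  obtain m :: nat where m: "B < m"
    using reals_Archimedean2 by blast
  let ?t = "\<lambda>l. \<phi> (s (l + Suc m)) (N m)"
  have sm: "summable (\<lambda>l. \<phi> (s l) (N m))"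
    using y(2) sums_summable by blast
  have "y (N m) = suminf ?t + (\<Sum>l<Suc m. \<phi> (s l) (N m))"
    using suminf_split_initial_segment[OF sm, of "Suc m"] sums_unique[OF y(2)] by simp
  then have "\<phi> (s m) (N m) = y (N m) - suminf ?t - (\<Sum>l<m. \<phi> (s l) (N m))"
    by (simp add: algebra_simps)
  moreover have "norm (p - q - r) \<le> norm p + norm q + norm r" for p q r :: 'b
    using norm_triangle_ineq4[of "p - q" r] norm_triangle_ineq4[of p q] by linarith
  ultimately have "norm (\<phi> (s m) (N m))
      \<le> norm (y (N m)) + norm (suminf ?t) + norm (\<Sum>l<m. \<phi> (s l) (N m))"
    by metis
  moreover have "norm (suminf ?t) \<le> 1"
  proof -
    have half: "(\<lambda>l. (1/2 :: real) ^ Suc l) sums 1"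
      by (rule power_half_series)
    have "norm (?t l) \<le> (1/2) ^ Suc l" for l
      using order_trans[OF later[of m "l + Suc m"] power_decreasing[of "Suc l" "l + Suc m" "1/2 :: real"]]
      by simp
    then have "norm (suminf ?t) \<le> (\<Sum>l. (1/2) ^ Suc l)"
      by (intro norm_suminf_le sums_summable[OF half])
    then show ?thesis
      using sums_unique[OF half] by simp
  qed
  moreover have "norm (\<Sum>l<m. \<phi> (s l) (N m)) \<le> (\<Sum>l<m. E (s l))"
    by (intro sum_norm_le E)
  ultimately show False
    using hump[of m] y(1)[of "N m"] m by linarith
qed

section \<open>Coordinates of an operator weighted shift\<close>

definition single :: "nat \<Rightarrow> 'a \<Rightarrow> 'a :: complex_hilbert_space l2"
  where "single k x = Abs_l2 (\<lambda>n. if n = k then x else 0)"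

lemma l2_nth_single: "l2_nth (single k x) n = (if n = k then x else 0)"
proof -
  have "summable (\<lambda>n. (norm (if n = k then x else 0))\<^sup>2)"
    by (rule summable_finite[of "{k}"]) auto
  then show ?thesis
    by (simp add: single_def l2_nth_Abs)
qed

lemma norm_single [simp]: "norm (single k x) = norm x"
proof -
  have "(norm (single k x))\<^sup>2 = (\<Sum>n\<in>{k}. (norm (l2_nth (single k x) n))\<^sup>2)"
    unfolding norm_l2_sq by (rule suminf_finite) (auto simp: l2_nth_single)
  then show ?thesis
    by (simp add: l2_nth_single)
qed

lemma l2_nth_sum: "l2_nth (\<Sum>i\<in>I. f i) n = (\<Sum>i\<in>I. l2_nth (f i) n)"
  by (induction I rule: infinite_finite_induct) (simp_all add: l2_nth_zero l2_nth_add)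

locale operator_weighted_shift =
  fixes A :: "nat \<Rightarrow> 'h :: complex_hilbert_space \<Rightarrow> 'h"
  assumes invertible_weights: "\<And>n. invertible_op (A n)"
    and bounded_weights: "bdd_above (range (\<lambda>n. onorm (A n)))"
begin

abbreviation T :: "'h l2 \<Rightarrow> 'h l2"
  where "T \<equiv> unilateral_shift A"

text \<open>The product of the \<open>j\<close> consecutive weights that start with \<open>A k\<close>.\<close>
definition W :: "nat \<Rightarrow> nat \<Rightarrow> 'h \<Rightarrow> 'h"
  where "W k = weight_product (\<lambda>i. A (k + i))"

text \<open>The maximum with \<open>1\<close> makes \<open>K\<close> positive, also on the trivial space.\<close>
definition K :: real
  where "K = max 1 (SUP n. onorm (A n))"

lemma K_ge_1: "1 \<le> K"
  by (simp add: K_def)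

lemma bounded_clinear_weight: "bounded_clinear (A n)"
  using invertible_weights by (simp add: invertible_op_def)

lemma bounded_linear_weight: "bounded_linear (A n)"
  using bounded_clinear_weight by (simp add: bounded_clinear_def)

lemma weight_scaleC: "A n (c *\<^sub>C x) = c *\<^sub>C A n x"
  using bounded_clinear_weight by (simp add: bounded_clinear_def)

lemma norm_weight_le: "norm (A n x) \<le> K * norm x"
proof -
  have "onorm (A n) \<le> K"
    unfolding K_def using cSUP_upper[OF UNIV_I bounded_weights, of n] by simp
  then show ?thesis
    using onorm[OF bounded_linear_weight, of n x] by (meson mult_right_mono norm_ge_zero order_trans)
qed

lemma bij_weight: "bij (A n)"
  using invertible_weights[of n] unfolding invertible_op_def by (metis o_bij)

lemma weight_zero [simp]: "A n 0 = 0"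
  by (rule linear_simps(3)[OF bounded_linear_weight])

lemma W_0 [simp]: "W k 0 x = x"
  by (simp add: W_def)

lemma W_Suc: "W k (Suc j) x = A (k + j) (W k j x)"
  by (simp add: W_def)

lemma W_start: "W 0 = weight_product A"
  by (simp add: W_def)

lemma W_add: "W k (i + j) x = W (k + i) j (W k i x)"
  by (induction j) (simp_all add: W_Suc add.assoc)

lemma bounded_linear_W: "bounded_linear (W k j)"
proof (induction j)
  case 0
  have "W k 0 = (\<lambda>x. x)" by (rule ext) simp
  then show ?case by simp
next
  case (Suc j)
  have "W k (Suc j) = (\<lambda>x. A (k + j) (W k j x))" by (rule ext) (rule W_Suc)
  then show ?case
    using bounded_linear_compose[OF bounded_linear_weight Suc] by simp
qed

lemmas W_linear = linear_simps[OF bounded_linear_W]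

lemma norm_W_le: "norm (W k j x) \<le> K ^ j * norm x"
proof (induction j)
  case (Suc j)
  have "norm (W k (Suc j) x) \<le> K * norm (W k j x)"
    unfolding W_Suc by (rule norm_weight_le)
  also have "\<dots> \<le> K * (K ^ j * norm x)"
    using K_ge_1 by (intro mult_left_mono Suc) simp
  finally show ?case by (simp add: mult.assoc)
qed simp

lemma bij_W: "bij (W k j)"
proof (induction j)
  case 0
  have "W k 0 = id" by (rule ext) simp
  then show ?case by (simp only: bij_id)
next
  case (Suc j)
  have "W k (Suc j) = A (k + j) \<circ> W k j" by (rule ext) (simp add: W_Suc)
  then show ?case
    using bij_comp[OF Suc bij_weight] by (simp only:)
qed

lemma W_eq_0_iff [simp]: "W k j x = 0 \<longleftrightarrow> x = 0"
  using bij_is_inj[OF bij_W] W_linear(3) by (metis injD)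

lemma W_inv: "W k j (inv (W k j) x) = x"
  using bij_is_surj[OF bij_W] by (rule surj_f_inv_f)

lemma nth_shift_0 [simp]: "l2_nth (T x) 0 = 0"
  and nth_shift_Suc [simp]: "l2_nth (T x) (Suc n) = A n (l2_nth x n)"
  using l2_nth_unilateral_shift[OF bounded_clinear_weight bounded_weights] by simp_all

lemma nth_shift_power: "l2_nth ((T ^^ n) x) i = (if i < n then 0 else W (i - n) n (l2_nth x (i - n)))"
proof (induction n arbitrary: i)
  case (Suc n)
  then show ?case
    by (cases i) (simp_all add: W_Suc)
qed simp

lemma shift_add: "T (x + y) = T x + T y"
  and shift_scaleC: "T (c *\<^sub>C x) = c *\<^sub>C T x"
  and shift_diff: "T (x - y) = T x - T y"
  by (rule l2_eqI, rename_tac n, case_tac n;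
      simp add: l2_nth_add l2_nth_diff l2_nth_scaleC linear_simps[OF bounded_linear_weight] weight_scaleC)+

lemma shift_zero [simp]: "T 0 = 0"
  using shift_scaleC[of 0 0] by simp

lemma shift_sum: "T (\<Sum>i\<in>I. f i) = (\<Sum>i\<in>I. T (f i))"
  by (induction I rule: infinite_finite_induct) (simp_all add: shift_add)

lemma shift_single: "T (single k x) = single (Suc k) (A k x)"
proof (rule l2_eqI)
  show "l2_nth (T (single k x)) n = l2_nth (single (Suc k) (A k x)) n" for n
    by (cases n) (simp_all add: l2_nth_single)
qed

text \<open>The coordinates of \<open>x\<close> are moved to pairwise different coordinates, so \<open>T ^^ n\<close> is an orthogonal sum
  of the operators \<open>W k n\<close>. Bounds for \<open>T ^^ n\<close> from above and from below are therefore uniform bounds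
  for these operators.\<close>
lemma norm_shift_power_sums:
  "(\<lambda>k. (norm (W k n (l2_nth x k)))\<^sup>2) sums (norm ((T ^^ n) x))\<^sup>2"
proof -
  let ?g = "\<lambda>i. (norm (l2_nth ((T ^^ n) x) i))\<^sup>2"
  have "?g sums (norm ((T ^^ n) x))\<^sup>2"
    unfolding norm_l2_sq by (rule summable_sums[OF summable_l2])
  then have "(\<lambda>i. ?g (i + n)) sums ((norm ((T ^^ n) x))\<^sup>2 - (\<Sum>i<n. ?g i))"
    by (rule sums_split_initial_segment)
  then show ?thesis
    by (simp add: nth_shift_power)
qed

lemma norm_shift_power_le:
  assumes "0 \<le> C" "\<And>k y. norm (W k n y) \<le> C * norm y"
  shows "norm ((T ^^ n) x) \<le> C * norm x"
proof (rule power2_le_imp_le)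
  have "(norm ((T ^^ n) x))\<^sup>2 \<le> C\<^sup>2 * (norm x)\<^sup>2"
  proof (rule sums_le[OF _ norm_shift_power_sums])
    show "(\<lambda>k. C\<^sup>2 * (norm (l2_nth x k))\<^sup>2) sums (C\<^sup>2 * (norm x)\<^sup>2)"
      unfolding norm_l2_sq by (intro sums_mult summable_sums summable_l2)
    show "(norm (W k n (l2_nth x k)))\<^sup>2 \<le> C\<^sup>2 * (norm (l2_nth x k))\<^sup>2" for k
      using power_mono[OF assms(2)[of k "l2_nth x k"], of 2] by (simp add: power_mult_distrib)
  qed
  then show "(norm ((T ^^ n) x))\<^sup>2 \<le> (C * norm x)\<^sup>2"
    by (simp add: power_mult_distrib)
qed (use assms(1) in simp)

lemma norm_shift_power_ge:
  assumes "0 \<le> c" "\<And>k y. c * norm y \<le> norm (W k n y)"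
  shows "c * norm x \<le> norm ((T ^^ n) x)"
proof (rule power2_le_imp_le)
  have "c\<^sup>2 * (norm x)\<^sup>2 \<le> (norm ((T ^^ n) x))\<^sup>2"
  proof (rule sums_le[OF _ _ norm_shift_power_sums])
    show "(\<lambda>k. c\<^sup>2 * (norm (l2_nth x k))\<^sup>2) sums (c\<^sup>2 * (norm x)\<^sup>2)"
      unfolding norm_l2_sq by (intro sums_mult summable_sums summable_l2)
    show "c\<^sup>2 * (norm (l2_nth x k))\<^sup>2 \<le> (norm (W k n (l2_nth x k)))\<^sup>2" for k
      using power_mono[OF assms(2)[of "l2_nth x k" k], of 2] assms(1) by (simp add: power_mult_distrib)
  qed
  then show "(c * norm x)\<^sup>2 \<le> (norm ((T ^^ n) x))\<^sup>2"
    by (simp add: power_mult_distrib)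
qed simp

lemma bounded_linear_inv_W: "bounded_linear (inv (W k j))"
proof (induction j)
  case 0
  have "W k 0 = id" by (rule ext) simp
  then show ?case by (simp add: id_def)
next
  case (Suc j)
  have "bounded_linear (inv (A (k + j)))"
  proof -
    obtain S where S: "bounded_clinear S" "S \<circ> A (k + j) = id" "A (k + j) \<circ> S = id"
      using invertible_weights by (auto simp: invertible_op_def)
    then show ?thesis
      using inv_unique_comp[OF S(3,2)] by (simp add: bounded_clinear_def)
  qed
  moreover have "W k (Suc j) = A (k + j) \<circ> W k j" by (rule ext) (simp add: W_Suc)
  then have "inv (W k (Suc j)) = (\<lambda>x. inv (W k j) (inv (A (k + j)) x))"
    using o_inv_distrib[OF bij_weight[of "k + j"] bij_W[of k j]] by (simp add: comp_def)
  ultimately show ?case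
    using bounded_linear_compose[OF Suc] by simp
qed

lemma norm_le_onorm_inv_W: "norm y \<le> onorm (inv (W k j)) * norm (W k j y)"
  using onorm[OF bounded_linear_inv_W, of k j "W k j y"] bij_is_inj[OF bij_W[of k j]] by simp

lemma bounded_clinear_shift: "bounded_clinear T"
proof -
  have "bounded_linear T"
  proof (rule bounded_linear_intro[where K = K])
    show "norm (T x) \<le> norm x * K" for x
      using norm_shift_power_le[of K 1 x] norm_weight_le K_ge_1
      by (simp add: W_Suc[of _ 0, simplified] mult.commute)
  qed (simp_all add: shift_add scaleR_scaleC shift_scaleC)
  then show ?thesis
    by (simp add: bounded_clinear_def shift_scaleC)
qed

lemma shift_power_single: "(T ^^ n) (single k x) = single (k + n) (W k n x)"
  by (induction n) (simp_all add: shift_single W_Suc)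

section \<open>Uniform estimates along orbits\<close>

text \<open>The truncation at \<open>N\<close> of the Neumann series of the resolvent at \<open>single k x\<close>, up to the factor \<open>- z powi (p + 1)\<close>.\<close>
definition orbit_sum :: "nat \<Rightarrow> 'h \<Rightarrow> nat \<Rightarrow> int \<Rightarrow> complex \<Rightarrow> 'h l2"
  where "orbit_sum k x N p z = (\<Sum>j\<le>N. (z powi (p - int j)) *\<^sub>C single (k + j) (W k j x))"

lemma orbit_sum_telescopes:
  assumes "z \<noteq> 0"
  shows "T (orbit_sum k x N p z) - z *\<^sub>C orbit_sum k x N p z =
    (z powi (p - int N)) *\<^sub>C single (k + Suc N) (W k (Suc N) x) - (z powi (p + 1)) *\<^sub>C single k x"
proof (induction N)
  case 0
  then show ?case
    using assms by (simp add: orbit_sum_def shift_scaleC shift_single scaleC_scaleC W_Suc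
        power_int_add_1')
next
  case (Suc N)
  have z: "z * z powi (p - int (Suc N)) = z powi (p - int N)"
    using power_int_add_1'[of z "p - int (Suc N)"] assms by (simp add: algebra_simps)
  let ?u = "(z powi (p - int (Suc N))) *\<^sub>C single (k + Suc N) (W k (Suc N) x)"
  have "orbit_sum k x (Suc N) p z = orbit_sum k x N p z + ?u"
    by (simp add: orbit_sum_def)
  moreover have "T ?u = (z powi (p - int (Suc N))) *\<^sub>C single (k + Suc (Suc N)) (W k (Suc (Suc N)) x)"
    by (simp add: shift_scaleC shift_single W_Suc)
  moreover have "z *\<^sub>C ?u = (z powi (p - int N)) *\<^sub>C single (k + Suc N) (W k (Suc N) x)"
    by (simp only: scaleC_scaleC z)
  ultimately show ?case
    using Suc by (simp only: shift_add scaleC_add_right) (simp add: algebra_simps)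
qed

lemma nth_orbit_sum:
  "l2_nth (orbit_sum k x N p z) n =
    (if k \<le> n \<and> n \<le> k + N then (z powi (p - int (n - k))) *\<^sub>C W k (n - k) x else 0)"
proof -
  have "l2_nth (orbit_sum k x N p z) n =
      (\<Sum>j\<le>N. if j = n - k \<and> k \<le> n then (z powi (p - int j)) *\<^sub>C W k j x else 0)"
    unfolding orbit_sum_def l2_nth_sum l2_nth_scaleC l2_nth_single
    by (intro sum.cong) auto
  also have "\<dots> = (if k \<le> n \<and> n \<le> k + N then (z powi (p - int (n - k))) *\<^sub>C W k (n - k) x else 0)"
    by (cases "k \<le> n") (auto simp: sum.delta)
  finally show ?thesis .
qed

text \<open>The map \<open>T - z\<close> need not be bounded below, but coordinate by coordinate it can be inverted
  continuously: coordinate \<open>0\<close> of \<open>T y - z *\<^sub>C y\<close> is \<open>- z *\<^sub>C l2_nth y 0\<close>, and coordinate \<open>n + 1\<close> determines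
  \<open>l2_nth y (n + 1)\<close> from \<open>l2_nth y n\<close>.\<close>
lemma coordinates_tendsto_0:
  assumes "z \<noteq> 0" and "(\<lambda>m. T (d m) - z *\<^sub>C d m) \<longlonglongrightarrow> 0"
  shows "(\<lambda>m. l2_nth (d m) n) \<longlonglongrightarrow> 0"
proof -
  define e where "e m = T (d m) - z *\<^sub>C d m" for m
  have "(\<lambda>m. norm (e m)) \<longlonglongrightarrow> 0"
    using assms(2) by (simp add: e_def tendsto_norm_zero_iff)
  then have e: "(\<lambda>m. l2_nth (e m) i) \<longlonglongrightarrow> 0" for i
    by (rule tendsto_0_le[where K = 1]) (simp add: norm_l2_nth_le)
  have d: "(1 / z) *\<^sub>C (l2_nth (T (d m)) i - l2_nth (e m) i) = l2_nth (d m) i" for m i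
    using assms(1) by (simp add: e_def l2_nth_diff l2_nth_scaleC scaleC_scaleC)
  show ?thesis
  proof (induction n)
    case 0
    have "(\<lambda>m. (1 / z) *\<^sub>C (0 - l2_nth (e m) 0)) \<longlonglongrightarrow> (1 / z) *\<^sub>C (0 - 0)"
      by (intro scaleC.tendsto tendsto_const tendsto_diff e)
    then show ?case
      using d[of _ 0] by simp
  next
    case (Suc n)
    have "(\<lambda>m. (1 / z) *\<^sub>C (A n (l2_nth (d m) n) - l2_nth (e m) (Suc n))) \<longlonglongrightarrow> (1 / z) *\<^sub>C (A n 0 - 0)"
      by (intro scaleC.tendsto tendsto_const tendsto_diff e bounded_linear.tendsto[OF bounded_linear_weight] Suc)
    then show ?case
      using d[of _ "Suc n"] by simp
  qed
qed

lemma orbit_sum_complex_derivative: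
  assumes "z \<noteq> 0"
  shows "\<exists>f'. (orbit_sum k x N p has_derivative (\<lambda>h. h *\<^sub>C f')) (at z within U)"
  using complex_derivative_sum[OF complex_derivative_monomial[OF assms]]
  by (simp add: orbit_sum_def[abs_def])

text \<open>Here the closed range enters. The images of the orbit sums under
  \<open>T - z\<close> form two Laurent series that converge uniformly on the annulus, so their sum is again an
  image, of \<open>G\<close> say. Although the orbit sums themselves need not form a convergent series, their
  coordinates at \<open>\<tau>\<close> sum up to those of \<open>G \<tau>\<close>.\<close>
lemma orbit_sum_series:
  assumes beta: "property_beta T" and r: "0 < s" "s < \<tau>" "\<tau> < \<rho>"
    and small: "\<And>m. (s powi (p m - int (N m)) + \<rho> powi (p m - int (N m))) * norm (W (k m) (Suc (N m)) (x m))
        + (s powi (p m + 1) + \<rho> powi (p m + 1)) * norm (x m) \<le> (1/2) ^ m"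
  shows "\<exists>y. \<forall>n. (\<lambda>m. l2_nth (orbit_sum (k m) (x m) (N m) (p m) (complex_of_real \<tau>)) n) sums l2_nth y n"
proof -
  define U where "U = {z. s < cmod z \<and> cmod z < \<rho>}"
  have "open U"
    unfolding U_def by (intro open_Collect_conj open_Collect_less continuous_intros)
  have U: "z \<noteq> 0" "s < cmod z" "cmod z < \<rho>" if "z \<in> U" for z
    using that r by (auto simp: U_def)
  have \<tau>: "complex_of_real \<tau> \<in> U"
    using r by (simp add: U_def)
  define f where "f m = orbit_sum (k m) (x m) (N m) (p m)" for m
  define u where "u m = single (k m + Suc (N m)) (W (k m) (Suc (N m)) (x m))" for m
  define v where "v m = single (k m) (x m)" for m
  define q where "q m = p m - int (N m)" for m
  have f: "T (f m z) - z *\<^sub>C f m z = (z powi q m) *\<^sub>C u m - (z powi (p m + 1)) *\<^sub>C v m"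
    if "z \<in> U" for m z
    using orbit_sum_telescopes[OF U(1)[OF that]] by (simp add: f_def u_def v_def q_def)
  have nonneg: "0 \<le> (s powi i + \<rho> powi i) * norm w" for i and w :: 'h
    using r by simp
  have u: "(s powi q m + \<rho> powi q m) * norm (u m) \<le> (1/2) ^ m" for m
    using small[of m] nonneg[of "p m + 1" "x m"] unfolding u_def norm_single q_def by linarith
  have v: "(s powi (p m + 1) + \<rho> powi (p m + 1)) * norm (v m) \<le> (1/2) ^ m" for m
    using small[of m] nonneg[of "p m - int (N m)" "W (k m) (Suc (N m)) (x m)"]
    unfolding v_def norm_single by linarith
  have half: "summable (\<lambda>m. (1/2 :: real) ^ m)"
    by (rule summable_geometric) simp
  define gu where "gu z = (\<Sum>m. (z powi q m) *\<^sub>C u m)" for z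
  define gv where "gv z = (\<Sum>m. (z powi (p m + 1)) *\<^sub>C v m)" for z
  have lu: "uniform_limit U (\<lambda>M z. \<Sum>m<M. (z powi q m) *\<^sub>C u m) gu sequentially"
    unfolding gu_def
    by (rule Weierstrass_m_test[OF norm_laurent_term_le[OF r(1) u] half]) (use U in auto)
  have lv: "uniform_limit U (\<lambda>M z. \<Sum>m<M. (z powi (p m + 1)) *\<^sub>C v m) gv sequentially"
    unfolding gv_def
    by (rule Weierstrass_m_test[OF norm_laurent_term_le[OF r(1) v] half]) (use U in auto)
  define g where "g = restrict (\<lambda>z. gu z - gv z) U"
  define F where "F M = restrict (\<lambda>z. \<Sum>m<M. f m z) U" for M
  have g_analytic: "g \<in> analytic_functions U"
    unfolding g_def
  proof (intro restrict_in_analytic_functions complex_derivative_diff)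
    fix z assume z: "z \<in> U"
    show "\<exists>f'. (gu has_derivative (\<lambda>h. h *\<^sub>C f')) (at z within U)"
      using laurent_series_differentiable[OF r(1) u U(2,3)[OF z]] has_derivative_at_withinI
      unfolding gu_def by blast
    show "\<exists>f'. (gv has_derivative (\<lambda>h. h *\<^sub>C f')) (at z within U)"
      using laurent_series_differentiable[OF r(1) v U(2,3)[OF z]] has_derivative_at_withinI
      unfolding gv_def by blast
  qed
  have F_analytic: "F M \<in> analytic_functions U" for M
    unfolding F_def f_def
    by (intro restrict_in_analytic_functions complex_derivative_sum orbit_sum_complex_derivative U)
  have bishop_F: "bishop_map T U (F M) z =
      (\<Sum>m<M. (z powi q m) *\<^sub>C u m) - (\<Sum>m<M. (z powi (p m + 1)) *\<^sub>C v m)" if "z \<in> U" for M z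
    using that f[OF that]
    by (simp add: bishop_map_def F_def shift_sum scaleC.sum_right flip: sum_subtractf)
  have "uniform_limit U (\<lambda>M. bishop_map T U (F M)) g sequentially"
  proof -
    have "uniform_limit U (\<lambda>M z. (\<Sum>m<M. (z powi q m) *\<^sub>C u m) - (\<Sum>m<M. (z powi (p m + 1)) *\<^sub>C v m))
        (\<lambda>z. gu z - gv z) sequentially"
      by (rule uniform_limit_minus[OF lu lv])
    then show ?thesis
      by (rule uniform_limit_cong'[THEN iffD1, rotated 2]) (simp_all add: bishop_F g_def)
  qed
  then obtain G where "bishop_map T U G = g"
    using property_beta_closed_range[OF beta \<open>open U\<close>, of F g, OF F_analytic g_analytic] by blast
  define t where "t = complex_of_real \<tau>"
  have "t \<in> U"
    using \<tau> by (simp add: t_def)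
  define d where "d M = G t - (\<Sum>m<M. f m t)" for M
  have "T (d M) - t *\<^sub>C d M = g t - bishop_map T U (F M) t" for M
  proof -
    have "g t = T (G t) - t *\<^sub>C G t"
      using \<open>bishop_map T U G = g\<close> \<open>t \<in> U\<close> by (auto simp: bishop_map_def)
    then show ?thesis
      using \<open>t \<in> U\<close> by (simp add: d_def bishop_map_def F_def shift_diff scaleC.diff_right)
  qed
  moreover have "(\<lambda>M. bishop_map T U (F M) t) \<longlonglongrightarrow> g t"
    using \<open>uniform_limit U _ g sequentially\<close> \<open>t \<in> U\<close> by (rule tendsto_uniform_limitI)
  then have "(\<lambda>M. g t - bishop_map T U (F M) t) \<longlonglongrightarrow> g t - g t"
    by (intro tendsto_intros)
  ultimately have "(\<lambda>M. T (d M) - t *\<^sub>C d M) \<longlonglongrightarrow> 0"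
    by simp
  then have "(\<lambda>M. l2_nth (d M) n) \<longlonglongrightarrow> 0" for n
    by (rule coordinates_tendsto_0[OF U(1)[OF \<open>t \<in> U\<close>]])
  then have "(\<lambda>M. l2_nth (G t) n - l2_nth (d M) n) \<longlonglongrightarrow> l2_nth (G t) n - 0" for n
    by (intro tendsto_intros)
  then have "(\<lambda>m. l2_nth (f m t) n) sums l2_nth (G t) n" for n
    by (simp add: sums_def d_def l2_nth_diff l2_nth_sum)
  then show ?thesis
    unfolding f_def t_def by blast
qed

text \<open>The hypotheses of \<open>gliding_hump\<close> hold for the coordinates of orbit sums at \<open>\<tau>\<close>, where the cost is
  a bound for the two end terms on the annulus.\<close>
lemma orbit_estimate:
  assumes beta: "property_beta T" and r: "0 < s" "s < \<tau>" "\<tau> < \<rho>"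
  shows "\<exists>C>0. \<forall>k x N p j. j \<le> N \<longrightarrow> \<tau> powi (p - int j) * norm (W k j x) \<le>
    C * ((s powi (p - int N) + \<rho> powi (p - int N)) * norm (W k (Suc N) x)
        + (s powi (p + 1) + \<rho> powi (p + 1)) * norm x)"
proof -
  define t where "t = complex_of_real \<tau>"
  define a :: "nat \<times> 'h \<times> nat \<times> int \<Rightarrow> real" where
    "a = (\<lambda>(k, x, N, p). (s powi (p - int N) + \<rho> powi (p - int N)) * norm (W k (Suc N) x)
        + (s powi (p + 1) + \<rho> powi (p + 1)) * norm x)"
  define \<phi> :: "nat \<times> 'h \<times> nat \<times> int \<Rightarrow> nat \<Rightarrow> 'h" where
    "\<phi> = (\<lambda>(k, x, N, p). l2_nth (orbit_sum k x N p t))"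
  have "\<exists>C>0. \<forall>i n. norm (\<phi> i n) \<le> C * a i"
  proof (rule gliding_hump)
    fix i :: "nat \<times> 'h \<times> nat \<times> int"
    obtain k x N p where i: "i = (k, x, N, p)"
      by (cases i) auto
    show "0 \<le> a i"
      using r by (simp add: a_def i)
    show "\<exists>E. \<forall>n. norm (\<phi> i n) \<le> E"
      using norm_l2_nth_le by (auto simp: \<phi>_def i)
    show "\<exists>i'. a i' = c * a i \<and> (\<forall>n. \<phi> i' n = c *\<^sub>R \<phi> i n)" if "0 < c" for c
    proof (intro exI[of _ "(k, c *\<^sub>R x, N, p)"] conjI allI)
      show "a (k, c *\<^sub>R x, N, p) = c * a i"
        using that by (simp add: a_def i W_linear algebra_simps)
      show "\<phi> (k, c *\<^sub>R x, N, p) n = c *\<^sub>R \<phi> i n" for n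
        by (simp add: \<phi>_def i nth_orbit_sum W_linear scaleC.scaleR_right)
    qed
  next
    fix n
    \<comment> \<open>Coordinate \<open>n\<close> sees at most \<open>n\<close> weights, whatever the length of the orbit sum; the sum over \<open>j\<close>
          is a convenient bound for the maximum.\<close>
    define D where "D = (\<Sum>j\<le>n. K ^ j * \<tau> powi (- int (Suc j)))"
    have "norm (\<phi> i n) \<le> D * a i" for i
    proof -
      obtain k x N p where i: "i = (k, x, N, p)"
        by (cases i) auto
      have pos: "0 \<le> D * a i"
        using r K_ge_1 by (auto simp: a_def i D_def intro!: mult_nonneg_nonneg add_nonneg_nonneg sum_nonneg)
      define j where "j = n - k"
      have "\<tau> powi (p - int j) * norm (W k j x) \<le> \<tau> powi (p - int j) * (K ^ j * norm x)"
        using r by (intro mult_left_mono norm_W_le) auto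
      also have "\<tau> powi (p - int j) * (K ^ j * norm x)
          = K ^ j * \<tau> powi (- int (Suc j)) * (\<tau> powi (p + 1) * norm x)"
      proof -
        have "\<tau> powi (p - int j) = \<tau> powi (- int (Suc j)) * \<tau> powi (p + 1)"
          using r by (simp flip: power_int_add)
        then show ?thesis
          by (simp only: mult_ac)
      qed
      also have "\<dots> \<le> D * a i"
      proof (rule mult_mono)
        show "K ^ j * \<tau> powi (- int (Suc j)) \<le> D"
          unfolding D_def using r K_ge_1
          by (intro member_le_sum[of j "{..n}" "\<lambda>j. K ^ j * \<tau> powi (- int (Suc j))"]) (auto simp: j_def)
        have "\<tau> powi (p + 1) * norm x \<le> (s powi (p + 1) + \<rho> powi (p + 1)) * norm x"
          using r by (intro mult_right_mono powi_le_endpoints) auto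
        also have "\<dots> \<le> a i"
          using r by (simp add: a_def i)
        finally show "\<tau> powi (p + 1) * norm x \<le> a i" .
        show "0 \<le> D"
          using r K_ge_1 by (auto simp: D_def intro!: sum_nonneg)
        show "0 \<le> \<tau> powi (p + 1) * norm x"
          using r by simp
      qed
      finally have "\<tau> powi (p - int j) * norm (W k j x) \<le> D * a i" .
      then show ?thesis
        using pos r unfolding \<phi>_def i prod.case nth_orbit_sum j_def[symmetric]
        by (simp add: norm_scaleC norm_power_int t_def)
    qed
    then show "\<exists>D. \<forall>i. norm (\<phi> i n) \<le> D * a i"
      by blast
  next
    fix i :: "nat \<Rightarrow> nat \<times> 'h \<times> nat \<times> int"
    assume i: "\<And>m. a (i m) \<le> (1/2) ^ m"
    define k x N p where "k m = fst (i m)" and "x m = fst (snd (i m))"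
      and "N m = fst (snd (snd (i m)))" and "p m = snd (snd (snd (i m)))" for m
    have i': "i m = (k m, x m, N m, p m)" for m
      by (simp add: k_def x_def N_def p_def)
    obtain y where "\<And>n. (\<lambda>m. \<phi> (i m) n) sums l2_nth y n"
      using orbit_sum_series[OF beta r, of p N k x] i by (auto simp: i' a_def \<phi>_def t_def)
    then show "\<exists>y B. \<forall>n. norm (y n) \<le> B \<and> (\<lambda>m. \<phi> (i m) n) sums y n"
      using norm_l2_nth_le by blast
  qed
  then obtain C where C: "C > 0" "\<And>i n. norm (\<phi> i n) \<le> C * a i"
    by blast
  have "\<tau> powi (p - int j) * norm (W k j x) \<le> C * a (k, x, N, p)" if "j \<le> N" for k x N p j
    using C(2)[of "(k, x, N, p)" "k + j"] that r
    by (simp add: \<phi>_def nth_orbit_sum norm_scaleC norm_power_int t_def)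
  then show ?thesis
    using C(1) by (auto simp: a_def)
qed

text \<open>Exponent \<open>p = -1\<close>: the start of the orbit has weight \<open>1\<close> and its end weight \<open>s ^ n\<close> in the
  denominator. With the outer radius \<open>2 * \<tau>\<close> the terms \<open>(2 * \<tau>) ^ - n\<close> are absorbed by \<open>s ^ - n\<close>.\<close>
lemma orbit_upper_estimate:
  assumes beta: "property_beta T" and r: "0 < s" "s < \<tau>"
  shows "\<exists>C>0. \<forall>k x j n. j < n \<longrightarrow> norm (W k j x) \<le> C * \<tau> ^ j * (norm x + norm (W k n x) / s ^ n)"
proof -
  obtain C where C: "C > 0" and est: "\<And>k x N p j. j \<le> N \<Longrightarrow> \<tau> powi (p - int j) * norm (W k j x) \<le>
    C * ((s powi (p - int N) + (2 * \<tau>) powi (p - int N)) * norm (W k (Suc N) x)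
        + (s powi (p + 1) + (2 * \<tau>) powi (p + 1)) * norm x)"
    using orbit_estimate[OF beta r, of "2 * \<tau>"] r by auto
  have "norm (W k j x) \<le> 2 * C * \<tau> * \<tau> ^ j * (norm x + norm (W k n x) / s ^ n)" if jn: "j < n" for k x j n
  proof -
    obtain N where N: "n = Suc N" "j \<le> N"
      using jn by (cases n) auto
    have eq: "b powi (- 1 - int i) = 1 / b ^ Suc i" if "b > 0" for b :: real and i
    proof -
      have "- 1 - int i = - int (Suc i)" by simp
      then show ?thesis
        by (simp only: power_int_minus power_int_of_nat inverse_eq_divide)
    qed
    have "1 / \<tau> ^ Suc j * norm (W k j x) \<le> C * ((1 / s ^ n + 1 / (2 * \<tau>) ^ n) * norm (W k n x) + 2 * norm x)"
      using est[OF N(2), of "-1" k x] r by (simp add: eq N(1) del: power_Suc)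
    also have "\<dots> \<le> C * ((1 / s ^ n + 1 / s ^ n) * norm (W k n x) + 2 * norm x)"
      using C r by (intro mult_left_mono add_mono mult_right_mono divide_left_mono power_mono) auto
    also have "\<dots> = 2 * C * (norm x + norm (W k n x) / s ^ n)"
      by (simp add: field_simps)
    finally show ?thesis
      using r by (simp add: field_simps)
  qed
  then show ?thesis
    using C r by (intro exI[of _ "2 * C * \<tau>"]) auto
qed

text \<open>Exponent \<open>p = N\<close>: now the end of the orbit has weight \<open>1\<close> and its start weight \<open>\<rho> ^ (N + 1)\<close>.
  With the inner radius \<open>\<tau> / 2\<close> the terms \<open>(\<tau> / 2) ^ (N + 1)\<close> are absorbed by \<open>\<rho> ^ (N + 1)\<close>.\<close>
lemma orbit_lower_estimate:
  assumes beta: "property_beta T" and r: "0 < \<tau>" "\<tau> < \<rho>"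
  shows "\<exists>C>0. \<forall>k x i j. 0 < i \<longrightarrow> \<tau> ^ i * norm (W k j x) \<le> C * (norm (W k (j + i) x) + \<rho> ^ (j + i) * norm x)"
proof -
  obtain C where C: "C > 0" and est: "\<And>k x N p j. j \<le> N \<Longrightarrow> \<tau> powi (p - int j) * norm (W k j x) \<le>
    C * (((\<tau> / 2) powi (p - int N) + \<rho> powi (p - int N)) * norm (W k (Suc N) x)
        + ((\<tau> / 2) powi (p + 1) + \<rho> powi (p + 1)) * norm x)"
    using orbit_estimate[OF beta, of "\<tau> / 2" \<tau> \<rho>] r by auto
  have "\<tau> ^ i * norm (W k j x) \<le> 2 * C * \<tau> * (norm (W k (j + i) x) + \<rho> ^ (j + i) * norm x)"
    if i: "0 < i" for k x i j
  proof -
    obtain l where l: "i = Suc l"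
      using i by (cases i) auto
    have eq: "b powi (int (j + l) + 1) = b ^ (j + i)" for b :: real
    proof -
      have "int (j + l) + 1 = int (j + i)" by (simp add: l)
      then show ?thesis by (simp only: power_int_of_nat)
    qed
    have "\<tau> ^ l * norm (W k j x) \<le> C * (2 * norm (W k (j + i) x) + ((\<tau> / 2) ^ (j + i) + \<rho> ^ (j + i)) * norm x)"
      using est[of j "j + l" "int (j + l)" k x] unfolding eq by (simp add: l)
    also have "\<dots> \<le> C * (2 * norm (W k (j + i) x) + (\<rho> ^ (j + i) + \<rho> ^ (j + i)) * norm x)"
      using C r by (intro mult_left_mono add_mono mult_right_mono power_mono) auto
    finally have "\<tau> * (\<tau> ^ l * norm (W k j x)) \<le> \<tau> * (2 * C * (norm (W k (j + i) x) + \<rho> ^ (j + i) * norm x))"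
      using r by (intro mult_left_mono) (simp_all add: algebra_simps)
    then show ?thesis
      by (simp add: l mult_ac)
  qed
  then show ?thesis
    using C r by (intro exI[of _ "2 * C * \<tau>"]) auto
qed

text \<open>The limit \<open>n \<rightarrow> \<infinity>\<close> in \<open>orbit_upper_estimate\<close>: the slow growth of each orbit from coordinate \<open>0\<close>,
  without any uniformity, already gives a common bound for all its pieces.\<close>
lemma uniform_growth_upper_bound:
  assumes beta: "property_beta T" and r: "0 < s" "s < \<tau>"
  shows "\<exists>C>0. \<forall>y. (\<lambda>n. norm (W 0 n y) / s ^ n) \<longlonglongrightarrow> 0 \<longrightarrow>
    (\<forall>k j. norm (W 0 (k + j) y) \<le> C * \<tau> ^ j * norm (W 0 k y))"
proof -
  obtain C where C: "C > 0"
    "\<And>k x j n. j < n \<Longrightarrow> norm (W k j x) \<le> C * \<tau> ^ j * (norm x + norm (W k n x) / s ^ n)"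
    using orbit_upper_estimate[OF beta r] by blast
  have "norm (W 0 (k + j) y) \<le> C * \<tau> ^ j * norm (W 0 k y)"
    if y: "(\<lambda>n. norm (W 0 n y) / s ^ n) \<longlonglongrightarrow> 0" for y k j
  proof (rule tendsto_lowerbound)
    have "(\<lambda>n. s ^ k * (norm (W 0 (n + k) y) / s ^ (n + k))) \<longlonglongrightarrow> s ^ k * 0"
      by (intro tendsto_intros LIMSEQ_ignore_initial_segment[OF y])
    then have "(\<lambda>n. norm (W k n (W 0 k y)) / s ^ n) \<longlonglongrightarrow> 0"
      using r W_add[of 0 k _ y] by (simp add: power_add add.commute)
    then have "(\<lambda>n. C * \<tau> ^ j * (norm (W 0 k y) + norm (W k n (W 0 k y)) / s ^ n))
        \<longlonglongrightarrow> C * \<tau> ^ j * (norm (W 0 k y) + 0)"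
      by (intro tendsto_intros)
    then show "(\<lambda>n. C * \<tau> ^ j * (norm (W 0 k y) + norm (W k n (W 0 k y)) / s ^ n))
        \<longlonglongrightarrow> C * \<tau> ^ j * norm (W 0 k y)"
      by simp
    show "\<forall>\<^sub>F n in sequentially. norm (W 0 (k + j) y) \<le>
        C * \<tau> ^ j * (norm (W 0 k y) + norm (W k n (W 0 k y)) / s ^ n)"
      using eventually_gt_at_top[of j]
    proof eventually_elim
      case (elim n)
      show ?case
        using C(2)[OF elim, of k "W 0 k y"] W_add[of 0 k j y] by simp
    qed
  qed simp
  then show ?thesis
    using C(1) by blast
qed

text \<open>Apply \<open>orbit_lower_estimate\<close> to the orbit from coordinate \<open>0\<close> to coordinate \<open>k + j\<close>. Its
  growth is fast by hypothesis, hence so is the growth on its final piece, from \<open>k\<close> to \<open>k + j\<close>.\<close>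
lemma uniform_growth_lower_bound:
  assumes beta: "property_beta T" and r: "0 < \<tau>" "\<tau> < \<rho>" and c: "0 < c"
  shows "\<exists>c'>0. \<forall>y. (\<forall>n. c * \<rho> ^ n * norm y \<le> norm (W 0 n y)) \<longrightarrow>
    (\<forall>k j. c' * \<tau> ^ j * norm (W 0 k y) \<le> norm (W 0 (k + j) y))"
proof -
  obtain C where C: "C > 0"
    "\<And>k x i j. 0 < i \<Longrightarrow> \<tau> ^ i * norm (W k j x) \<le> C * (norm (W k (j + i) x) + \<rho> ^ (j + i) * norm x)"
    using orbit_lower_estimate[OF beta r] by blast
  define D where "D = 1 + C * (1 + 1 / c)"
  have D: "D \<ge> 1" "C * (1 + 1 / c) \<le> D"
    using C c by (simp_all add: D_def)
  have "1 / D * \<tau> ^ j * norm (W 0 k y) \<le> norm (W 0 (k + j) y)"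
    if y: "\<And>n. c * \<rho> ^ n * norm y \<le> norm (W 0 n y)" for y k j
  proof -
    have "\<tau> ^ j * norm (W 0 k y) \<le> D * norm (W 0 (k + j) y)"
    proof (cases "j = 0")
      case True
      then show ?thesis
        using mult_right_mono[OF D(1), of "norm (W 0 k y)"] by simp
    next
      case False
      have "\<rho> ^ (k + j) * norm y \<le> norm (W 0 (k + j) y) / c"
        using y[of "k + j"] c by (simp add: field_simps)
      then have "C * (norm (W 0 (k + j) y) + \<rho> ^ (k + j) * norm y)
          \<le> C * (norm (W 0 (k + j) y) + norm (W 0 (k + j) y) / c)"
        using C by (intro mult_left_mono add_left_mono) auto
      also have "\<dots> = C * (1 + 1 / c) * norm (W 0 (k + j) y)"
        by (simp add: algebra_simps)
      also have "\<dots> \<le> D * norm (W 0 (k + j) y)"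
        by (intro mult_right_mono D) simp
      finally show ?thesis
        using C(2)[of j 0 k y] False by simp
    qed
    then show ?thesis
      using D by (simp add: field_simps)
  qed
  then show ?thesis
    using D by (intro exI[of _ "1 / D"]) auto
qed

end

section \<open>Exponential growth rates\<close>

lemma root_const_mult_power:
  assumes "0 < n" "0 \<le> t"
  shows "root n (c * t ^ n) = root n c * t"
  using assms by (simp add: real_root_mult real_root_power_cancel)

lemma tendsto_root_const_mult_power:
  assumes "0 < c" "0 \<le> t"
  shows "(\<lambda>n. root n (c * t ^ n)) \<longlonglongrightarrow> t"
proof -
  have "(\<lambda>n. root n c * t) \<longlonglongrightarrow> 1 * t"
    by (intro tendsto_intros LIMSEQ_root_const assms)
  then have "(\<lambda>n. root n c * t) \<longlonglongrightarrow> t"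
    by simp
  then show ?thesis
    by (rule Lim_transform_eventually)
      (use eventually_gt_at_top[of 0] in eventually_elim, simp add: root_const_mult_power assms)
qed

text \<open>All the limits of \<open>n\<close>-th roots are obtained from geometric bounds with constants that
  disappear in the limit.\<close>
lemma root_tendsto_growth_rate:
  fixes u :: "nat \<Rightarrow> real"
  assumes nonneg: "\<And>n. 0 \<le> u n" and L: "0 \<le> L"
    and upper: "\<And>t. L < t \<Longrightarrow> \<exists>C>0. \<forall>n. u n \<le> C * t ^ n"
    and lower: "\<And>t. 0 < t \<Longrightarrow> t < L \<Longrightarrow> \<exists>c>0. \<forall>n. c * t ^ n \<le> u n"
  shows "(\<lambda>n. root n (u n)) \<longlonglongrightarrow> L"
proof (rule order_tendstoI)
  fix a assume a: "L < a"
  define t where "t = (L + a) / 2"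
  have t: "L < t" "t < a"
    using a by (simp_all add: t_def)
  obtain C where C: "C > 0" "\<And>n. u n \<le> C * t ^ n"
    using upper[OF t(1)] by blast
  have "\<forall>\<^sub>F n in sequentially. root n (C * t ^ n) < a"
    by (rule order_tendstoD(2)[OF tendsto_root_const_mult_power t(2)]) (use C L t in auto)
  then show "\<forall>\<^sub>F n in sequentially. root n (u n) < a"
    using eventually_gt_at_top[of 0]
  proof eventually_elim
    case (elim n)
    then show ?case
      using real_root_le_mono[OF elim(2) C(2)[of n]] by linarith
  qed
next
  fix a assume a: "a < L"
  show "\<forall>\<^sub>F n in sequentially. a < root n (u n)"
  proof (cases "a < 0")
    case True
    have "0 \<le> root n (u n)" for n
      using nonneg by (rule real_root_ge_zero)
    then show ?thesis
      using True by (intro always_eventually allI) (rule less_le_trans)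
  next
    case False
    define t where "t = (L + a) / 2"
    have t: "0 < t" "t < L" "a < t"
      using a False by (simp_all add: t_def)
    obtain c where c: "c > 0" "\<And>n. c * t ^ n \<le> u n"
      using lower[OF t(1,2)] by blast
    have "\<forall>\<^sub>F n in sequentially. a < root n (c * t ^ n)"
      by (rule order_tendstoD(1)[OF tendsto_root_const_mult_power t(3)]) (use c t in auto)
    then show ?thesis
      using eventually_gt_at_top[of 0]
    proof eventually_elim
      case (elim n)
      then show ?case
        using real_root_le_mono[OF elim(2) c(2)[of n]] by linarith
    qed
  qed
qed

lemma limsup_root_le:
  fixes u :: "nat \<Rightarrow> real"
  assumes "0 < C" "0 \<le> t" "\<And>n. u n \<le> C * t ^ n"
  shows "limsup (\<lambda>n. ereal (root n (u n))) \<le> ereal t"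
proof -
  have "limsup (\<lambda>n. ereal (root n (u n))) \<le> limsup (\<lambda>n. ereal (root n (C * t ^ n)))"
    by (rule Limsup_mono) (use eventually_gt_at_top[of 0] in eventually_elim, simp add: assms)
  also have "\<dots> = ereal t"
    by (intro lim_imp_Limsup tendsto_ereal tendsto_root_const_mult_power assms) simp
  finally show ?thesis .
qed

lemma eventually_geometric_lower_bound:
  fixes u :: "nat \<Rightarrow> real"
  assumes pos: "\<And>n. 0 < u n" and t: "0 < t" and ev: "\<forall>\<^sub>F n in sequentially. t ^ n \<le> u n"
  shows "\<exists>c>0. \<forall>n. c * t ^ n \<le> u n"
proof -
  obtain N where N: "\<And>n. n \<ge> N \<Longrightarrow> t ^ n \<le> u n"
    using ev by (auto simp: eventually_sequentially)
  define c where "c = Min (insert 1 ((\<lambda>n. u n / t ^ n) ` {..<N}))"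
  have "c > 0"
    using pos t by (simp add: c_def)
  moreover have "c * t ^ n \<le> u n" for n
  proof (cases "n < N")
    case True
    then have "c \<le> u n / t ^ n"
      by (auto simp: c_def)
    then show ?thesis
      using t by (simp add: pos_le_divide_eq)
  next
    case False
    have "c \<le> 1"
      by (simp add: c_def)
    then have "c * t ^ n \<le> t ^ n"
      using t by (simp add: mult_left_le_one_le \<open>c > 0\<close> less_imp_le)
    then show ?thesis
      using N[of n] False by simp
  qed
  ultimately show ?thesis
    by blast
qed

section \<open>The lower radius\<close>

context operator_weighted_shift
begin

text \<open>With \<open>\<mu> = r\<^sub>2\<close>: below \<open>\<mu>\<close> the products \<open>W 0 n\<close> are bounded below geometrically, which
  \<open>uniform_growth_lower_bound\<close> transfers to all \<open>W k n\<close>. Above \<open>\<mu>\<close> there are arbitrarily large \<open>n\<close> and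
  vectors \<open>y\<close> (depending on \<open>n\<close>) that grow slowly up to time \<open>n\<close>; by \<open>orbit_upper_estimate\<close> they grow slowly up to
  every earlier time, so \<open>T ^^ j\<close> has a small lower bound for every \<open>j\<close>. This shows directly that
  the limit which defines \<open>r\<^sub>1\<close> exists.\<close>
lemma lower_radius_eq_r2:
  assumes beta: "property_beta T" and nonzero: "\<exists>x :: 'h. x \<noteq> 0"
  shows "r2_shift A = ereal (lower_radius T)"
proof -
  define a where "a n = onorm (inv (W 0 n))" for n
  define \<Lambda> where "\<Lambda> = limsup (\<lambda>n. ereal (root n (a n)))"
  obtain x0 :: 'h where x0: "x0 \<noteq> 0"
    using nonzero by blast
  have bl: "bounded_linear (inv (W 0 n))" for n
    by (rule bounded_linear_inv_W)
  have a_lower: "norm y \<le> a n * norm (W 0 n y)" for n y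
    unfolding a_def by (rule norm_le_onorm_inv_W)
  have a_ge: "1 / K ^ n \<le> a n" for n
  proof -
    have "0 \<le> a n"
      unfolding a_def by (rule onorm_pos_le[OF bl])
    have "norm x0 \<le> a n * (K ^ n * norm x0)"
      using a_lower[of x0 n] mult_left_mono[OF norm_W_le[of 0 n x0] \<open>0 \<le> a n\<close>] by simp
    then have "1 * norm x0 \<le> (a n * K ^ n) * norm x0"
      by (simp add: mult.assoc)
    then have "1 \<le> a n * K ^ n"
      using x0 by (simp only: mult_le_cancel_right) simp
    then show ?thesis
      using K_ge_1 by (simp add: pos_divide_le_eq)
  qed
  have a_pos: "0 < a n" for n
    using less_le_trans[OF _ a_ge[of n]] K_ge_1 by simp
  have "ereal (1 / K) \<le> \<Lambda>"
    unfolding \<Lambda>_def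
  proof (rule le_Limsup)
    show "\<forall>\<^sub>F n in sequentially. ereal (1 / K) \<le> ereal (root n (a n))"
      using eventually_gt_at_top[of 0]
    proof eventually_elim
      case (elim n)
      have "1 / K = root n (1 / K ^ n)"
        using K_ge_1 elim by (simp add: real_root_divide real_root_power_cancel)
      then show ?case
        using real_root_le_mono[OF elim a_ge[of n]] by simp
    qed
  qed simp
  moreover have "0 < ereal (1 / K)"
    using K_ge_1 by simp
  ultimately have \<Lambda>_pos: "0 < \<Lambda>"
    by (rule less_le_trans[rotated])
  \<comment> \<open>The limes superior is positive but may be infinite; \<open>\<mu>\<close> is its reciprocal as a real number.\<close>
  define \<mu> where "\<mu> = (if \<Lambda> = \<infinity> then 0 else 1 / real_of_ereal \<Lambda>)"
  consider r where "0 < r" "\<Lambda> = ereal r" "\<mu> = 1 / r" | "\<Lambda> = \<infinity>" "\<mu> = 0"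
    using \<Lambda>_pos by (cases \<Lambda>) (auto simp: \<mu>_def)
  note \<mu>_cases = this
  have \<mu>: "1 / \<Lambda> = ereal \<mu>"
    by (cases rule: \<mu>_cases) (simp_all add: one_ereal_def)
  have \<mu>0: "0 \<le> \<mu>"
    by (cases rule: \<mu>_cases) simp_all
  have below: "\<Lambda> < ereal (1 / t)" if "0 < t" "t < \<mu>" for t
    using that by (cases rule: \<mu>_cases) (simp_all add: field_simps)
  have above: "ereal (1 / t) < \<Lambda>" if "\<mu> < t" for t
  proof (cases rule: \<mu>_cases)
    case (1 r)
    have "0 < t"
      using that \<mu>0 by simp
    then show ?thesis
      using that 1 by (simp add: field_simps)
  qed simp
  have unit: "\<exists>x :: 'h l2. norm x = 1"
    using x0 by (intro exI[of _ "single 0 ((1 / norm x0) *\<^sub>R x0)"]) simp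
  have "(\<lambda>n. root n (lower_bound (T ^^ n))) \<longlonglongrightarrow> \<mu>"
  proof (rule root_tendsto_growth_rate[OF _ \<mu>0])
    show "0 \<le> lower_bound (T ^^ n)" for n
      unfolding lower_bound_def using unit by (intro cINF_greatest) auto
  next
    fix t assume t: "\<mu> < t"
    define s where "s = (\<mu> + t) / 2"
    have s: "\<mu> < s" "s < t" "0 < s"
      using t \<mu>0 by (simp_all add: s_def)
    obtain C where C: "C > 0"
      "\<And>k x j n. j < n \<Longrightarrow> norm (W k j x) \<le> C * t ^ j * (norm x + norm (W k n x) / s ^ n)"
      using orbit_upper_estimate[OF beta s(3,2)] by blast
    have "lower_bound (T ^^ j) \<le> C * 2 * t ^ j" for j
    proof -
      have "\<not> (\<forall>\<^sub>F n in sequentially. ereal (root n (a n)) \<le> ereal (1 / s))"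
        using Limsup_bounded[of "\<lambda>n. ereal (root n (a n))" "ereal (1 / s)" sequentially] above[OF s(1)]
        unfolding \<Lambda>_def by (meson not_le)
      then obtain n where n: "n \<ge> Suc j" "1 / s < root n (a n)"
        unfolding eventually_sequentially by (auto simp: not_le)
      then have "(1 / s) ^ n < a n"
        using power_strict_mono[of "1 / s" "root n (a n)" n] s real_root_pow_pos2[of n "a n"] a_pos[of n]
        by simp
      have "\<exists>v. (1 / s) ^ n * norm v < norm (inv (W 0 n) v)"
      proof (rule ccontr)
        assume "\<not> ?thesis"
        then have "a n \<le> (1 / s) ^ n"
          unfolding a_def using s by (intro onorm_bound) (auto simp: not_less)
        then show False
          using \<open>(1 / s) ^ n < a n\<close> by simp
      qed
      then obtain v where v: "(1 / s) ^ n * norm v < norm (inv (W 0 n) v)"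
        by blast
      define y where "y = inv (W 0 n) v"
      have "norm y > 0"
        using v s le_less_trans[OF _ v, of 0] by (simp add: y_def)
      have "W 0 n y = v"
        by (simp add: y_def W_inv)
      then have "norm (W 0 n y) / s ^ n \<le> norm y"
        using v by (simp add: y_def power_one_over)
      have "norm (W 0 j y) \<le> C * t ^ j * (norm y + norm (W 0 n y) / s ^ n)"
        using n by (intro C(2)) simp
      also have "\<dots> \<le> C * t ^ j * (norm y + norm y)"
        using C(1) s \<open>norm (W 0 n y) / s ^ n \<le> norm y\<close> by (intro mult_left_mono) auto
      finally have y: "norm (W 0 j y) \<le> C * 2 * t ^ j * norm y"
        by (simp add: algebra_simps)
      define e where "e = single 0 ((1 / norm y) *\<^sub>R y)"
      have "norm e = 1"
        using \<open>norm y > 0\<close> by (simp add: e_def)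
      have "lower_bound (T ^^ j) \<le> norm ((T ^^ j) e)"
        unfolding lower_bound_def using \<open>norm e = 1\<close>
        by (intro cINF_lower bdd_belowI[of _ 0]) auto
      also have "\<dots> = norm (W 0 j y) / norm y"
        by (simp add: e_def shift_power_single W_linear)
      also have "\<dots> \<le> C * 2 * t ^ j"
        using y \<open>norm y > 0\<close> by (simp add: pos_divide_le_eq)
      finally show ?thesis .
    qed
    then show "\<exists>C>0. \<forall>n. lower_bound (T ^^ n) \<le> C * t ^ n"
      using C(1) by (intro exI[of _ "C * 2"]) auto
  next
    fix t assume t: "0 < t" "t < \<mu>"
    define \<rho> where "\<rho> = (t + \<mu>) / 2"
    have \<rho>: "0 < \<rho>" "t < \<rho>" "\<rho> < \<mu>"
      using t by (simp_all add: \<rho>_def)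
    have "\<forall>\<^sub>F n in sequentially. ereal (root n (a n)) < ereal (1 / \<rho>)"
      by (rule Limsup_lessD) (use below[OF \<rho>(1,3)] in \<open>simp add: \<Lambda>_def\<close>)
    then have "\<forall>\<^sub>F n in sequentially. \<rho> ^ n \<le> 1 / a n"
      using eventually_gt_at_top[of 0]
    proof eventually_elim
      case (elim n)
      then have "a n \<le> (1 / \<rho>) ^ n"
        using power_mono[of "root n (a n)" "1 / \<rho>" n] real_root_pow_pos2[of n "a n"] a_pos[of n]
        by (simp add: less_imp_le)
      then show ?case
        using \<rho> a_pos[of n] by (simp add: field_simps)
    qed
    then obtain c where c: "c > 0" "\<And>n. c * \<rho> ^ n \<le> 1 / a n"
      using eventually_geometric_lower_bound[of "\<lambda>n. 1 / a n" \<rho>] a_pos \<rho> by auto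
    obtain c' where c': "c' > 0" "\<And>y. (\<forall>n. c * \<rho> ^ n * norm y \<le> norm (W 0 n y)) \<Longrightarrow>
        (\<forall>k j. c' * t ^ j * norm (W 0 k y) \<le> norm (W 0 (k + j) y))"
      using uniform_growth_lower_bound[OF beta t(1) \<rho>(2) c(1)] by blast
    have B: "c * \<rho> ^ n * norm y \<le> norm (W 0 n y)" for n y
    proof -
      have "c * \<rho> ^ n * norm y \<le> 1 / a n * (a n * norm (W 0 n y))"
        using c \<rho> a_pos[of n] by (intro mult_mono a_lower) (auto simp: less_imp_le)
      then show ?thesis
        using a_pos[of n] by simp
    qed
    have W: "c' * t ^ n * norm y \<le> norm (W k n y)" for k n y
      using c'(2)[of "inv (W 0 k) y", rule_format, OF B, of n k] W_add[of 0 k n "inv (W 0 k) y"]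
      by (simp add: W_inv)
    have "c' * t ^ n \<le> lower_bound (T ^^ n)" for n
      unfolding lower_bound_def
    proof (rule cINF_greatest)
      show "{x :: 'h l2. norm x = 1} \<noteq> {}"
        using unit by simp
      show "c' * t ^ n \<le> norm ((T ^^ n) x)" if "x \<in> {x. norm x = 1}" for x
        using norm_shift_power_ge[of "c' * t ^ n" n x] W c'(1) t that by simp
    qed
    then show "\<exists>c>0. \<forall>n. c * t ^ n \<le> lower_bound (T ^^ n)"
      using c'(1) by blast
  qed
  then have "lower_radius T = \<mu>"
    unfolding lower_radius_def by (rule limI)
  moreover have "r2_shift A = 1 / \<Lambda>"
    by (simp add: r2_shift_def \<Lambda>_def a_def W_start)
  ultimately show ?thesis
    using \<mu> by simp
qed

end

section \<open>The spectral radius\<close>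

lemma invertible_op_of_geometric_power_bound:
  fixes T :: "'a :: complex_hilbert_space \<Rightarrow> 'a"
  assumes T: "bounded_clinear T" and \<tau>: "0 < \<tau>" "\<tau> < cmod z"
    and C: "\<And>n x. norm ((T ^^ n) x) \<le> C * \<tau> ^ n * norm x"
  shows "invertible_op (\<lambda>x. T x - z *\<^sub>C x)"
proof -
  have bl: "bounded_linear T" and Tc: "T (c *\<^sub>C x) = c *\<^sub>C T x" for c x
    using T by (auto simp: bounded_clinear_def)
  note Tl = linear_simps[OF bl]
  have z: "z \<noteq> 0"
    using \<tau> by auto
  have pow: "(T ^^ n) (x + y) = (T ^^ n) x + (T ^^ n) y" "(T ^^ n) (c *\<^sub>C x) = c *\<^sub>C ((T ^^ n) x)" for n x y c
    by (induction n) (simp_all add: Tl Tc)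
  define g where "g n x = (- ((1 / z) ^ Suc n)) *\<^sub>C ((T ^^ n) x)" for n x
  define B where "B n = C / cmod z * (\<tau> / cmod z) ^ n" for n
  have gB: "norm (g n x) \<le> B n * norm x" for n x
  proof -
    have "norm (g n x) = norm ((T ^^ n) x) / cmod z ^ Suc n"
      by (simp add: g_def norm_scaleC norm_power norm_divide power_divide norm_mult)
    also have "\<dots> \<le> C * \<tau> ^ n * norm x / cmod z ^ Suc n"
      by (intro divide_right_mono C) simp
    finally show ?thesis
      by (simp add: B_def power_divide mult_ac)
  qed
  have "norm (\<tau> / cmod z) < 1"
    using \<tau> z by simp
  then have sB: "summable B"
    unfolding B_def by (intro summable_mult summable_geometric)
  have sg: "summable (\<lambda>n. g n x)" for x
    by (rule summable_comparison_test'[OF summable_mult2[OF sB, of "norm x"]]) (rule gB)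
  define S where "S x = (\<Sum>n. g n x)" for x
  have S_add: "S (x + y) = S x + S y" for x y
    unfolding S_def suminf_add[OF sg sg] by (simp add: g_def pow scaleC.add_right)
  have S_scale: "S (c *\<^sub>C x) = c *\<^sub>C S x" for c x
    unfolding S_def bounded_linear.suminf[OF scaleC.bounded_linear_right sg]
    by (simp add: g_def pow scaleC_scaleC mult.commute)
  have S_norm: "norm (S x) \<le> norm x * suminf B" for x
  proof -
    have "norm (S x) \<le> (\<Sum>n. B n * norm x)"
      unfolding S_def by (intro norm_suminf_le gB summable_mult2 sB)
    then show ?thesis
      by (simp add: mult.commute flip: suminf_mult2[OF sB])
  qed
  have bS: "bounded_linear S"
    using S_norm by (intro bounded_linear_intro[where K = "suminf B"]) (simp_all add: S_add S_scale scaleR_scaleC)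
  have S_diff: "S (x - y) = S x - S y" for x y
    by (rule linear_simps(2)[OF bS])
  have TS: "T (S x) = S (T x)" for x
    unfolding S_def bounded_linear.suminf[OF bl sg] by (simp add: g_def Tc funpow_swap1)
  have ST: "S (T x - z *\<^sub>C x) = x" for x
  proof -
    have eq: "z *\<^sub>C g (Suc n) x = g n (T x)" for n
      using z by (simp add: g_def scaleC_scaleC funpow_swap1)
    have "z *\<^sub>C S x = (\<Sum>n. z *\<^sub>C g n x)"
      unfolding S_def by (rule bounded_linear.suminf[OF scaleC.bounded_linear_right sg])
    also have "\<dots> = z *\<^sub>C g 0 x + (\<Sum>n. z *\<^sub>C g (Suc n) x)"
      using suminf_split_head[OF bounded_linear.summable[OF scaleC.bounded_linear_right sg], of z x] by simp
    also have "\<dots> = - x + S (T x)"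
      unfolding eq S_def using z by (simp add: g_def scaleC_scaleC scaleC.minus_left scaleC.minus_right)
    finally show ?thesis
      by (simp add: S_diff S_scale)
  qed
  have "bounded_clinear S"
    using bS S_scale by (simp add: bounded_clinear_def)
  moreover have "bounded_clinear (\<lambda>x. T x - z *\<^sub>C x)"
    unfolding bounded_clinear_def
    by (auto intro!: bounded_linear_sub bl scaleC.bounded_linear_right
        simp: Tc scaleC.diff_right scaleC_scaleC mult.commute)
  moreover have "S \<circ> (\<lambda>x. T x - z *\<^sub>C x) = id" "(\<lambda>x. T x - z *\<^sub>C x) \<circ> S = id"
    using ST by (auto simp: fun_eq_iff TS simp flip: S_scale S_diff)
  ultimately show ?thesis
    unfolding invertible_op_def by blast
qed

context operator_weighted_shift
begin

text \<open>Comparing coordinates, the only possible solution has \<open>W 0 n x = - z ^ (n + 1) *\<^sub>C l2_nth y n\<close>; that it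
  is square summable limits the growth of \<open>W 0 n x\<close>.\<close>
lemma norm_W_le_of_solution:
  assumes "z \<noteq> 0" and y: "T y - z *\<^sub>C y = single 0 x"
  shows "norm (W 0 n x) \<le> cmod z * norm y * cmod z ^ n"
proof -
  have coord: "l2_nth (T y) n - z *\<^sub>C l2_nth y n = (if n = 0 then x else 0)" for n
    using y by (simp flip: l2_nth_diff l2_nth_scaleC l2_nth_single)
  have W: "W 0 n x = (- (z ^ Suc n)) *\<^sub>C l2_nth y n"
  proof (induction n)
    case 0
    then show ?case
      using coord[of 0] by (simp add: scaleC.minus_left)
  next
    case (Suc n)
    have "A n (l2_nth y n) = z *\<^sub>C l2_nth y (Suc n)"
      using coord[of "Suc n"] by simp
    then show ?case
      by (simp add: W_Suc Suc weight_scaleC scaleC_scaleC mult_ac)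
  qed
  have "norm (W 0 n x) = cmod z ^ Suc n * norm (l2_nth y n)"
    unfolding W by (simp add: norm_scaleC norm_mult norm_power)
  also have "\<dots> \<le> cmod z ^ Suc n * norm y"
    by (intro mult_left_mono norm_l2_nth_le) simp
  finally show ?thesis
    by (simp add: mult_ac)
qed

text \<open>Above \<open>R\<^sub>3\<^sup>+\<close> all orbits grow slowly, so \<open>uniform_growth_upper_bound\<close> bounds the powers of \<open>T\<close>
  and the Neumann series inverts \<open>T - z\<close>. Conversely, a positive \<open>t\<close> outside the spectrum bounds all growth rates by
  \<open>norm_W_le_of_solution\<close>. The point \<open>0\<close> belongs to the spectrum, since coordinate \<open>0\<close> of every \<open>T y\<close> is \<open>0\<close>; this excludes the
  junk value of a supremum over the empty set.\<close>
lemma spectral_radius_eq_R3: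
  assumes beta: "property_beta T" and nonzero: "\<exists>x :: 'h. x \<noteq> 0"
  shows "ereal (spectral_radius T) = R3_plus_shift A"
proof -
  define \<Lambda> where "\<Lambda> x = limsup (\<lambda>n. ereal (root n (norm (W 0 n x))))" for x
  have R3: "R3_plus_shift A = (SUP x\<in>{x. x \<noteq> 0}. \<Lambda> x)"
    by (simp add: R3_plus_shift_def \<Lambda>_def W_start)
  obtain x0 :: 'h where x0: "x0 \<noteq> 0"
    using nonzero by blast
  have \<Lambda>_le: "\<Lambda> x \<le> ereal t" if "0 < C" "0 \<le> t" "\<And>n. norm (W 0 n x) \<le> C * t ^ n" for x C t
    unfolding \<Lambda>_def using that by (rule limsup_root_le)
  have "R3_plus_shift A \<le> ereal K"
    unfolding R3
  proof (rule SUP_least)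
    fix x :: 'h assume "x \<in> {x. x \<noteq> 0}"
    then show "\<Lambda> x \<le> ereal K"
      using norm_W_le[of 0 _ x] K_ge_1 by (intro \<Lambda>_le[of "norm x"]) (simp_all add: mult.commute)
  qed
  moreover have "0 \<le> R3_plus_shift A"
  proof -
    have "0 \<le> \<Lambda> x0"
      unfolding \<Lambda>_def by (intro le_Limsup always_eventually) (simp_all add: real_root_ge_zero)
    also have "\<dots> \<le> R3_plus_shift A"
      unfolding R3 using x0 by (intro SUP_upper) simp
    finally show ?thesis .
  qed
  ultimately obtain R where R: "R3_plus_shift A = ereal R" "0 \<le> R"
    by (cases "R3_plus_shift A") auto
  have \<Lambda>_R: "\<Lambda> x \<le> ereal R" if "x \<noteq> 0" for x
    using that R(1) SUP_upper[of x "{x. x \<noteq> 0}" \<Lambda>] by (simp add: R3)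
  have resolvent: "z \<notin> spectrum T \<Longrightarrow> \<exists>y. T y - z *\<^sub>C y = w" for z w
    unfolding spectrum_def invertible_op_def by (auto simp: fun_eq_iff)
  have "0 \<in> spectrum T"
  proof (rule ccontr)
    assume "0 \<notin> spectrum T"
    then obtain y where "T y - 0 *\<^sub>C y = single 0 x0"
      using resolvent by blast
    then have "l2_nth (T y) 0 = x0"
      by (simp add: l2_nth_single)
    then show False
      using x0 by simp
  qed
  have "spectral_radius T = R"
    unfolding spectral_radius_def
  proof (rule cSup_eq_non_empty)
    show "cmod ` spectrum T \<noteq> {}"
      using \<open>0 \<in> spectrum T\<close> by auto
  next
    fix r assume "r \<in> cmod ` spectrum T"
    then obtain z where z: "z \<in> spectrum T" "r = cmod z"
      by blast
    show "r \<le> R"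
    proof (rule ccontr)
      assume "\<not> r \<le> R"
      define q where "q = (3 * R + r) / 4"
      define s where "s = (R + r) / 2"
      define \<tau> where "\<tau> = (R + 3 * r) / 4"
      have r: "R < q" "0 < q" "q < s" "0 < s" "s < \<tau>" "\<tau> < r"
        using \<open>\<not> r \<le> R\<close> R(2) by (auto simp: q_def s_def \<tau>_def field_simps)
      have growth: "(\<lambda>n. norm (W 0 n y) / s ^ n) \<longlonglongrightarrow> 0" for y
      proof (cases "y = 0")
        case False
        have "\<forall>\<^sub>F n in sequentially. ereal (root n (norm (W 0 n y))) < ereal q"
          using \<Lambda>_R[OF False] r(1) unfolding \<Lambda>_def
          by (intro Limsup_lessD) (meson ereal_less_eq(3) less_ereal.simps(1) le_less_trans)
        then have ev: "\<forall>\<^sub>F n in sequentially. norm (W 0 n y) / s ^ n \<le> (q / s) ^ n"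
          using eventually_gt_at_top[of 0]
        proof eventually_elim
          case (elim n)
          then have "norm (W 0 n y) \<le> q ^ n"
            using power_mono[of "root n (norm (W 0 n y))" q n] by (simp add: real_root_pow_pos2 less_imp_le)
          then show ?case
            using r by (simp add: power_divide divide_right_mono)
        qed
        show ?thesis
        proof (rule tendsto_sandwich[where f = "\<lambda>_. 0", OF _ ev])
          show "(\<lambda>n. (q / s) ^ n) \<longlonglongrightarrow> 0"
            using r by (intro LIMSEQ_power_zero) simp
          show "\<forall>\<^sub>F n in sequentially. 0 \<le> norm (W 0 n y) / s ^ n"
            using r by (intro always_eventually) simp
        qed simp
      qed (simp add: W_linear)
      obtain C where C: "C > 0" "\<And>y. (\<lambda>n. norm (W 0 n y) / s ^ n) \<longlonglongrightarrow> 0 \<Longrightarrow>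
          \<forall>k j. norm (W 0 (k + j) y) \<le> C * \<tau> ^ j * norm (W 0 k y)"
        using uniform_growth_upper_bound[OF beta r(4,5)] by blast
      have "norm (W k j y) \<le> C * \<tau> ^ j * norm y" for k j y
        using C(2)[OF growth, rule_format, of k j "inv (W 0 k) y"] W_add[of 0 k j "inv (W 0 k) y"] by (simp add: W_inv)
      then have "norm ((T ^^ n) x) \<le> C * \<tau> ^ n * norm x" for n x
        using C(1) r by (intro norm_shift_power_le) auto
      then have "invertible_op (\<lambda>x. T x - z *\<^sub>C x)"
        using r z by (intro invertible_op_of_geometric_power_bound[OF bounded_clinear_shift, of \<tau>]) auto
      then show False
        using z(1) by (simp add: spectrum_def)
    qed
  next
    fix u assume u: "\<And>r. r \<in> cmod ` spectrum T \<Longrightarrow> r \<le> u"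
    have "0 \<le> u"
      using u[of 0] \<open>0 \<in> spectrum T\<close> by force
    show "R \<le> u"
    proof (rule ccontr)
      assume "\<not> R \<le> u"
      define t where "t = (R + u) / 2"
      have t: "u < t" "t < R" "0 < t"
        using \<open>\<not> R \<le> u\<close> \<open>0 \<le> u\<close> by (auto simp: t_def)
      have "complex_of_real t \<notin> spectrum T"
        using u[of t] t by force
      have "R3_plus_shift A \<le> ereal t"
        unfolding R3
      proof (rule SUP_least)
        fix x :: 'h assume "x \<in> {x. x \<noteq> 0}"
        obtain y where y: "T y - complex_of_real t *\<^sub>C y = single 0 x"
          using resolvent[OF \<open>complex_of_real t \<notin> spectrum T\<close>] by blast
        have "y \<noteq> 0"
        proof
          assume "y = 0"
          then have "norm (single 0 x) = 0"
            using y by (metis diff_self norm_zero scaleC.zero_right shift_zero)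
          then show False
            using \<open>x \<in> {x. x \<noteq> 0}\<close> by simp
        qed
        then show "\<Lambda> x \<le> ereal t"
          using norm_W_le_of_solution[OF _ y] t by (intro \<Lambda>_le[of "t * norm y"]) simp_all
      qed
      then show False
        using R(1) t by simp
    qed
  qed
  then show ?thesis
    using R(1) by simp
qed

section \<open>Growth along a single orbit\<close>

text \<open>The common limit is the growth rate \<open>L\<close> of the orbit of \<open>x\<close>, here the infimum of the admissible geometric rates.
  The bound for the ratios from above is \<open>uniform_growth_upper_bound\<close>. For the bound
  from below the orbit must also grow at least like \<open>\<rho> ^ n\<close> for each \<open>\<rho> < L\<close>: if it fell
  below \<open>c * \<rho> ^ n\<close> for every \<open>c > 0\<close>, then \<open>orbit_upper_estimate\<close> would make some rate less than \<open>L\<close> admissible.\<close>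
lemma ratio_limits_agree:
  assumes beta: "property_beta T" and x: "x \<noteq> 0"
  shows "\<exists>L. (\<lambda>n. root n (INF k. norm (W 0 (n + k) x) / norm (W 0 k x))) \<longlonglongrightarrow> L \<and>
    (\<lambda>n. root n (SUP k. norm (W 0 (n + k) x) / norm (W 0 k x))) \<longlonglongrightarrow> L"
proof -
  define b where "b n = norm (W 0 n x)" for n
  have b: "b n > 0" for n
    using x by (simp add: b_def)
  define G where "G = {t. 0 < t \<and> (\<exists>C. \<forall>n. b n \<le> C * t ^ n)}"
  define L where "L = Inf G"
  have "K \<in> G"
    using K_ge_1 norm_W_le[of 0 _ x] by (auto simp: G_def b_def mult.commute intro!: exI[of _ "norm x"])
  have bdd: "bdd_below G"
    by (rule bdd_belowI[of _ 0]) (simp add: G_def)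
  have L0: "0 \<le> L"
    unfolding L_def using \<open>K \<in> G\<close> by (intro cInf_greatest) (auto simp: G_def)
  have upper: "\<exists>C>0. \<forall>k n. b (n + k) / b k \<le> C * t ^ n" if t: "L < t" for t
  proof -
    obtain r where r: "r \<in> G" "r < t"
      using cInf_lessD[of G t] t \<open>K \<in> G\<close> by (auto simp: L_def)
    then obtain C' where r': "0 < r" "\<And>n. b n \<le> C' * r ^ n"
      by (auto simp: G_def)
    define s where "s = (r + t) / 2"
    have s: "0 < s" "s < t" "r < s"
      using r r' by (simp_all add: s_def)
    have "(\<lambda>n. b n / s ^ n) \<longlonglongrightarrow> 0"
    proof (rule tendsto_sandwich[where f = "\<lambda>_. 0" and h = "\<lambda>n. C' * (r / s) ^ n"])
      have "(\<lambda>n. C' * (r / s) ^ n) \<longlonglongrightarrow> C' * 0"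
        using r' s by (intro tendsto_intros LIMSEQ_power_zero) simp
      then show "(\<lambda>n. C' * (r / s) ^ n) \<longlonglongrightarrow> 0"
        by simp
      show "\<forall>\<^sub>F n in sequentially. b n / s ^ n \<le> C' * (r / s) ^ n"
        using r'(2) s by (intro always_eventually) (simp add: power_divide divide_right_mono)
      show "\<forall>\<^sub>F n in sequentially. 0 \<le> b n / s ^ n"
        using b s by (intro always_eventually) (simp add: less_imp_le)
    qed simp
    moreover obtain C where "C > 0" "\<And>y. (\<lambda>n. norm (W 0 n y) / s ^ n) \<longlonglongrightarrow> 0 \<Longrightarrow>
        \<forall>k j. norm (W 0 (k + j) y) \<le> C * t ^ j * norm (W 0 k y)"
      using uniform_growth_upper_bound[OF beta s(1,2)] by blast
    ultimately have "b (k + n) \<le> C * t ^ n * b k" for k n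
      unfolding b_def by blast
    then have "b (n + k) / b k \<le> C * t ^ n" for k n
      using b by (simp add: pos_divide_le_eq add.commute)
    then show ?thesis
      using \<open>C > 0\<close> by blast
  qed
  have lower: "\<exists>c>0. \<forall>k n. c * t ^ n \<le> b (n + k) / b k" if t: "0 < t" "t < L" for t
  proof -
    define \<rho> where "\<rho> = (t + L) / 2"
    define \<sigma> where "\<sigma> = (\<rho> + L) / 2"
    have r: "0 < \<rho>" "t < \<rho>" "\<rho> < \<sigma>" "\<sigma> < L"
      using t by (auto simp: \<rho>_def \<sigma>_def field_simps)
    have "\<exists>c>0. \<forall>n. c * \<rho> ^ n \<le> b n"
    proof (rule ccontr)
      assume "\<not> ?thesis"
      then have small: "\<exists>n. b n < c * \<rho> ^ n" if "c > 0" for c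
        using that by (meson not_le)
      obtain C where C: "C > 0"
        "\<And>k x j n. j < n \<Longrightarrow> norm (W k j x) \<le> C * \<sigma> ^ j * (norm x + norm (W k n x) / \<rho> ^ n)"
        using orbit_upper_estimate[OF beta r(1,3)] by blast
      have "b j \<le> C * (b 0 + 1) * \<sigma> ^ j" for j
      proof -
        \<comment> \<open>A time \<open>n\<close> at which the orbit drops below \<open>c * \<rho> ^ n\<close> must come after \<open>j\<close>.\<close>
        define c where "c = Min (insert 1 ((\<lambda>i. b i / \<rho> ^ i) ` {..j}))"
        have "c > 0"
          using b r by (simp add: c_def)
        then obtain n where n: "b n < c * \<rho> ^ n"
          using small by blast
        then have n': "b n / \<rho> ^ n < c"
          using r by (simp add: pos_divide_less_eq)
        have "j < n"
        proof (rule ccontr)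
          assume "\<not> j < n"
          then have "c \<le> b n / \<rho> ^ n"
            unfolding c_def by (intro Min_le) auto
          then show False
            using n' by simp
        qed
        have "c \<le> 1"
          by (simp add: c_def)
        have "b j \<le> C * \<sigma> ^ j * (b 0 + b n / \<rho> ^ n)"
          using C(2)[OF \<open>j < n\<close>, of 0 x] by (simp add: b_def)
        also have "\<dots> \<le> C * \<sigma> ^ j * (b 0 + 1)"
          using C(1) r less_le_trans[OF n' \<open>c \<le> 1\<close>] by (intro mult_left_mono add_left_mono) (auto simp del: divide_less_eq_1_pos divide_le_eq_1_pos)
        finally show ?thesis
          by (simp add: mult_ac)
      qed
      then have "\<sigma> \<in> G"
        using r by (auto simp: G_def)
      then have "L \<le> \<sigma>"
        unfolding L_def using bdd by (rule cInf_lower)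
      then show False
        using r by simp
    qed
    then obtain c where c: "c > 0" "\<And>n. c * \<rho> ^ n \<le> b n"
      by blast
    have "c / norm x > 0"
      using c x by simp
    then obtain c' where c': "c' > 0" "\<And>y. (\<forall>n. c / norm x * \<rho> ^ n * norm y \<le> norm (W 0 n y)) \<Longrightarrow>
        (\<forall>k j. c' * t ^ j * norm (W 0 k y) \<le> norm (W 0 (k + j) y))"
      using uniform_growth_lower_bound[OF beta t(1) r(2)] by blast
    have "\<forall>n. c / norm x * \<rho> ^ n * norm x \<le> norm (W 0 n x)"
      using c(2) x by (simp add: b_def)
    then have "c' * t ^ n * b k \<le> b (k + n)" for k n
      using c'(2) by (simp add: b_def)
    then have "c' * t ^ n \<le> b (n + k) / b k" for k n
      unfolding pos_le_divide_eq[OF b] add.commute[of n k] by blast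
    then show ?thesis
      using c'(1) by blast
  qed
  have ratio_nonneg: "0 \<le> b (n + k) / b k" for n k
    using b by (simp add: less_imp_le)
  have bdd_ratio: "bdd_above (range (\<lambda>k. b (n + k) / b k))" for n
    using upper[of "L + 1"] unfolding bdd_above_def by fastforce
  have bdd_ratio': "bdd_below (range (\<lambda>k. b (n + k) / b k))" for n
    using ratio_nonneg by (auto intro!: bdd_belowI[of _ 0])
  have ge: "(INF k. b (n + k) / b k) \<le> b (n + 0) / b 0"
    and le: "b (n + 0) / b 0 \<le> (SUP k. b (n + k) / b k)" for n
    by (rule cINF_lower[OF bdd_ratio' UNIV_I] cSUP_upper[OF UNIV_I bdd_ratio])+
  have "(\<lambda>n. root n (INF k. b (n + k) / b k)) \<longlonglongrightarrow> L"
  proof (rule root_tendsto_growth_rate[OF _ L0])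
    show "0 \<le> (INF k. b (n + k) / b k)" for n
      by (intro cINF_greatest ratio_nonneg) simp
    show "\<exists>C>0. \<forall>n. (INF k. b (n + k) / b k) \<le> C * t ^ n" if "L < t" for t
      using upper[OF that] ge by (meson order_trans)
    show "\<exists>c>0. \<forall>n. c * t ^ n \<le> (INF k. b (n + k) / b k)" if "0 < t" "t < L" for t
      using lower[OF that] by (metis (no_types, lifting) UNIV_not_empty cINF_greatest)
  qed
  moreover have "(\<lambda>n. root n (SUP k. b (n + k) / b k)) \<longlonglongrightarrow> L"
  proof (rule root_tendsto_growth_rate[OF _ L0])
    show "0 \<le> (SUP k. b (n + k) / b k)" for n
      using ratio_nonneg le order_trans by blast
    show "\<exists>C>0. \<forall>n. (SUP k. b (n + k) / b k) \<le> C * t ^ n" if "L < t" for t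
      using upper[OF that] by (metis (no_types, lifting) UNIV_not_empty cSUP_least)
    show "\<exists>c>0. \<forall>n. c * t ^ n \<le> (SUP k. b (n + k) / b k)" if "0 < t" "t < L" for t
      using lower[OF that] le by (meson order_trans)
  qed
  ultimately show ?thesis
    unfolding b_def by blast
qed

end

theorem theorem4p2:
  fixes A :: "nat \<Rightarrow> 'h :: complex_hilbert_space \<Rightarrow> 'h"
  assumes nonzero: "\<exists>x :: 'h. x \<noteq> 0"
    and inv: "\<And>n. invertible_op (A n)"
    and bdd: "bdd_above (range (\<lambda>n. onorm (A n)))"
    and beta: "property_beta (unilateral_shift A)"
  shows "r2_shift A = ereal (lower_radius (unilateral_shift A))
    \<and> ereal (spectral_radius (unilateral_shift A)) = R3_plus_shift A
    \<and> (\<forall>x. x \<noteq> 0 \<longrightarrow> (\<exists>L.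
        (\<lambda>n. root n (INF k. norm (weight_product A (n + k) x) / norm (weight_product A k x)))
          \<longlonglongrightarrow> L \<and>
        (\<lambda>n. root n (SUP k. norm (weight_product A (n + k) x) / norm (weight_product A k x)))
          \<longlonglongrightarrow> L))"
proof -
  interpret operator_weighted_shift A
    by unfold_locales (rule inv, rule bdd)
  show ?thesis
    using lower_radius_eq_r2[OF beta nonzero] spectral_radius_eq_R3[OF beta nonzero]
      ratio_limits_agree[OF beta]
    unfolding W_start by blast
qed

end
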